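(* Let $n\ge1$, and for $r=1,2$ let $\vec{\alpha_r}=(\alpha_{r1},\dots,\alpha_{rn})$ with all $\alpha_{ri}>0$, $\vec{p_r}=(p_{r1},\dots,p_{rn})$ with all $0<p_{ri}<1$, and $\vec{\beta_r}=(\beta_{r1},\dots,\beta_{rn})$ with all $\beta_{ri}>0$. Let $\mathcal{N}_r=\sum_{i=1}^n N_{\alpha_{ri},p_{ri}}$ and $\mathcal{G}_r=\sum_{i=1}^n G_{\alpha_{ri},\beta_{ri}}$, sums of independent negative binomial, resp. gamma, random variables. Then: (a) If $(\vec{\alpha_2},\vec{p_2})=^a((\vec{\alpha_2})_\uparrow,(\vec{p_2})_\downarrow)$, $\vec{\alpha_1}\prec_w\vec{\alpha_2}$ and $\vec{p_1}\prec^w\vec{p_2}$, then $\mathcal{N}_1\le_{conv}\mathcal{N}_2$. (b) If $(\vec{\alpha_2},\vec{\beta_2})=^a((\vec{\alpha_2})_\uparrow,(\vec{\beta_2})_\downarrow)$, $\vec{\alpha_1}\prec_w\vec{\alpha_2}$ and $\vec{\beta_1}\prec^w\vec{\beta_2}$, then $\mathcal{G}_1\le_{conv}\mathcal{G}_2$.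
   Context: For $\alpha>0$, $0<p<1$, $q=1-p$: $P(N_{\alpha,p}=k)=\binom{k+\alpha-1}{k}p^\alpha q^k$, $k=0,1,2,\dots$. For $\alpha,\beta>0$, $G_{\alpha,\beta}$ has density $\frac{\beta^\alpha t^{\alpha-1}}{\Gamma(\alpha)}e^{-\beta t}$ for $t\ge0$ and $0$ for $t<0$. $X_1\le_{conv}X_2$ means $X_2$ has the same distribution as $X_1+Z$ for some nonnegative random variable $Z$ independent of $X_1$. For $\vec{x}\in\mathbb{R}^n$, $\vec{x}_\uparrow=(x_{(1)},\dots,x_{(n)})$ and $\vec{x}_\downarrow=(x_{[1]},\dots,x_{[n]})$ are the vectors of components of $\vec x$ in increasing, resp. decreasing, order. $\vec{x}\prec^w\vec{y}$ means $\sum_{i=1}^k x_{(i)}\ge\sum_{i=1}^k y_{(i)}$ for $k=1,\dots,n$. $\vec{x}\prec_w\vec{y}$ means $\sum_{i=1}^k x_{[i]}\le\sum_{i=1}^k y_{[i]}$ for $k=1,\dots,n$. $(\vec{x_1},\vec{y_1})=^a(\vec{x_2},\vec{y_2})$ means that there is one permutation $\pi$ with $\vec{x_1}=\pi(\vec{x_2})$ and $\vec{y_1}=\pi(\vec{y_2})$. *)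

theory Defs
  imports "HOL-Probability.Probability" "HOL-Combinatorics.Combinatorics"
begin

definition negbin_prob :: "real \<Rightarrow> real \<Rightarrow> nat \<Rightarrow> real" where
  "negbin_prob \<alpha> p k = ((real k + \<alpha> - 1) gchoose k) * p powr \<alpha> * (1 - p) ^ k"

text \<open>The weights sum to one for \<open>\<alpha> > 0\<close> and \<open>0 < p < 1\<close>, so that the equation below determines the
  distribution of \<open>X\<close> although \<open>X\<close> is real-valued.\<close>

definition negbin_distributed :: "'a measure \<Rightarrow> ('a \<Rightarrow> real) \<Rightarrow> real \<Rightarrow> real \<Rightarrow> bool" where
  "negbin_distributed M X \<alpha> p \<longleftrightarrow>
     X \<in> borel_measurable M \<and>
     (\<forall>k::nat. measure M {\<omega> \<in> space M. X \<omega> = real k} = negbin_prob \<alpha> p k)"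

text \<open>Since \<open>0 powr a = 0\<close>, the value at \<open>t = 0\<close> is always \<open>0\<close> (for \<open>\<alpha> = 1\<close> the usual convention is \<open>\<beta>\<close>);
  this null set does not affect the distribution.\<close>

definition gamma_density :: "real \<Rightarrow> real \<Rightarrow> real \<Rightarrow> real" where
  "gamma_density \<alpha> \<beta> t =
     (if t < 0 then 0 else \<beta> powr \<alpha> * t powr (\<alpha> - 1) / Gamma \<alpha> * exp (- \<beta> * t))"

definition gamma_distributed :: "'a measure \<Rightarrow> ('a \<Rightarrow> real) \<Rightarrow> real \<Rightarrow> real \<Rightarrow> bool" where
  "gamma_distributed M X \<alpha> \<beta> \<longleftrightarrow> distributed M lborel X (\<lambda>t. ennreal (gamma_density \<alpha> \<beta> t))"

text \<open>The convolution order only concerns distributions: the space carrying \<open>X1\<close> need not carry a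
  suitable independent \<open>Z\<close>, so \<open>X1\<close> is replaced by an equidistributed copy \<open>X\<close> on some other
  probability space. Taking that space over \<open>real \<times> real\<close> is no restriction, because the joint law
  of \<open>(X, Z)\<close> lives there.\<close>

definition conv_le ::
  "'a measure \<Rightarrow> ('a \<Rightarrow> real) \<Rightarrow> 'b measure \<Rightarrow> ('b \<Rightarrow> real) \<Rightarrow> bool" where
  "conv_le M1 X1 M2 X2 \<longleftrightarrow>
     (\<exists>(M :: (real \<times> real) measure) X Z.
        prob_space M \<and>
        prob_space.indep_var M borel X borel Z \<and>
        (\<forall>\<omega>\<in>space M. 0 \<le> Z \<omega>) \<and>
        distr M borel X = distr M1 borel X1 \<and>
        distr M borel (\<lambda>\<omega>. X \<omega> + Z \<omega>) = distr M2 borel X2)"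

text \<open>Vectors are lists of reals.\<close>

definition increasing_arr :: "real list \<Rightarrow> real list" where
  "increasing_arr xs = sort xs"

definition decreasing_arr :: "real list \<Rightarrow> real list" where
  "decreasing_arr xs = rev (sort xs)"

definition weak_supermajorized :: "real list \<Rightarrow> real list \<Rightarrow> bool"  (infix "\<prec>\<^sup>w" 50) where
  "xs \<prec>\<^sup>w ys \<longleftrightarrow> length xs = length ys \<and>
     (\<forall>k\<in>{1..length xs}.
        sum_list (take k (increasing_arr xs)) \<ge> sum_list (take k (increasing_arr ys)))"

definition weak_submajorized :: "real list \<Rightarrow> real list \<Rightarrow> bool"  (infix "\<prec>\<^sub>w" 50) where
  "xs \<prec>\<^sub>w ys \<longleftrightarrow> length xs = length ys \<and>
     (\<forall>k\<in>{1..length xs}.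
        sum_list (take k (decreasing_arr xs)) \<le> sum_list (take k (decreasing_arr ys)))"

definition arrangement_eq ::
  "real list \<times> real list \<Rightarrow> real list \<times> real list \<Rightarrow> bool"  (infix "=\<^sup>a" 50) where
  "v1 =\<^sup>a v2 \<longleftrightarrow> length (fst v2) = length (snd v2) \<and>
     (\<exists>\<pi>. \<pi> permutes {..<length (fst v2)} \<and>
        fst v1 = permute_list \<pi> (fst v2) \<and> snd v1 = permute_list \<pi> (snd v2))"

end

theory Submission imports Defs "HOL-Real_Asymp.Real_Asymp" begin

text \<open>
  The law of \<open>N\<^bsub>\<alpha>,p\<^esub>\<close> is compound Poisson with Levy measure giving mass \<open>\<alpha> (1 - p)\<^sup>k / k\<close> to \<open>k \<ge> 1\<close>.
  Since \<open>x \<mapsto> (1 - x)\<^sup>k\<close> is nonnegative, decreasing and convex, the majorization hypotheses and the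
  opposite ordering of \<open>\<alpha>\<^sub>2\<close> and \<open>p\<^sub>2\<close> give
  \<open>\<Sum>\<^sub>i \<alpha>\<^sub>1\<^sub>i (1 - p\<^sub>1\<^sub>i)\<^sup>k \<le> \<Sum>\<^sub>i \<alpha>\<^sub>2\<^sub>i (1 - p\<^sub>2\<^sub>i)\<^sup>k\<close> by a weighted Tomic--Weyl inequality. So the difference of
  the two Levy measures is a measure, and \<open>Z\<close> is the compound Poisson variable belonging to it.
  The gamma law is the limit of \<open>N\<^bsub>\<alpha>,\<beta>/m\<^esub> / m\<close> as \<open>m \<rightarrow> \<infinity>\<close>, and scaling both \<open>\<beta>\<close>-vectors by \<open>1/m\<close> preserves the
  hypotheses. The rescaled variables \<open>Z\<^sub>m / m\<close> have bounded means, hence are tight, and any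
  subsequential limit is the \<open>Z\<close> required for the gamma sums.
\<close>

section \<open>Weighted sums under weak majorization\<close>

text \<open>Abel summation: the sum is a combination of the partial sums of \<open>x\<close> with
  coefficients \<open>d i - d (i + 1)\<close> and a last coefficient \<open>d (n - 1)\<close>, none
  of them negative. The induction carries the sharper lower bound \<open>d m\<close> times the
  partial sum, because the bound 0 alone does not propagate.\<close>

lemma sum_mult_nonneg_of_partial_sums:
  fixes d x :: "nat \<Rightarrow> real"
  assumes "\<And>i j. i \<le> j \<Longrightarrow> j < n \<Longrightarrow> d j \<le> d i" "\<And>i. i < n \<Longrightarrow> 0 \<le> d i"
    and "\<And>k. k \<le> n \<Longrightarrow> 0 \<le> (\<Sum>i<k. x i)"
  shows "0 \<le> (\<Sum>i<n. d i * x i)"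
proof -
  have "d m * (\<Sum>i<Suc m. x i) \<le> (\<Sum>i<Suc m. d i * x i)" if "Suc m \<le> n" for m
    using that
  proof (induction m)
    case (Suc m)
    have "d (Suc m) * (\<Sum>i<Suc (Suc m). x i)
        = d (Suc m) * (\<Sum>i<Suc m. x i) + d (Suc m) * x (Suc m)"
      by (simp add: algebra_simps)
    also have "\<dots> \<le> d m * (\<Sum>i<Suc m. x i) + d (Suc m) * x (Suc m)"
      using assms(1)[of m "Suc m"] assms(3)[of "Suc m"] Suc.prems
      by (intro add_right_mono mult_right_mono) auto
    also have "\<dots> \<le> (\<Sum>i<Suc (Suc m). d i * x i)"
      using Suc by simp
    finally show ?case .
  qed simp
  from this[of "n - 1"] assms(2)[of "n - 1"] assms(3)[of n] show ?thesis
    by (cases n) (auto intro: order_trans[OF mult_nonneg_nonneg])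
qed

text \<open>Remove the largest index \<open>m\<close> of \<open>S\<close>: a set with
  \<open>k + 1\<close> elements has \<open>m\<close> at least \<open>k\<close>, so
  \<open>D m\<close> is at most \<open>D k\<close>, and the rest is a set of size
  \<open>k\<close>.\<close>

lemma sum_subset_le_initial_sum:
  fixes D :: "nat \<Rightarrow> real"
  assumes "\<And>i j. i \<le> j \<Longrightarrow> j < n \<Longrightarrow> D j \<le> D i" "S \<subseteq> {..<n}" "card S = k"
  shows "sum D S \<le> (\<Sum>i<k. D i)"
  using assms(2,3)
proof (induction k arbitrary: S)
  case 0
  then show ?case by (auto simp: finite_subset card_eq_0_iff)
next
  case (Suc k)
  have fin: "finite S" and ne: "S \<noteq> {}"
    using Suc.prems by (auto intro: finite_subset)
  define m where "m = Max S"
  have m: "m \<in> S" "S \<subseteq> {..m}" using fin ne by (auto simp: m_def)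
  have "card S \<le> Suc m" using card_mono[OF _ m(2)] by simp
  then have "D m \<le> D k" using assms(1)[of k m] m Suc.prems by auto
  moreover have "sum D (S - {m}) \<le> (\<Sum>i<k. D i)"
    using Suc.prems m fin by (intro Suc.IH) auto
  ultimately show ?case
    using sum.remove[OF fin m(1), of D] by simp
qed

lemma sum_list_take_eq_sum:
  "k \<le> length xs \<Longrightarrow> sum_list (take k xs) = (\<Sum>i<k. xs ! i :: real)"
  by (simp add: sum_list_sum_nth atLeast0LessThan)

lemma permutes_mset_eq:
  assumes "mset xs = mset ys"
  obtains \<pi> where "\<pi> permutes {..<length xs}" "\<And>i. i < length xs \<Longrightarrow> xs ! i = ys ! \<pi> i"
proof -
  obtain \<pi> where "\<pi> permutes {..<length ys}" "permute_list \<pi> ys = xs"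
    using mset_eq_permutation[OF assms] by blast
  then show ?thesis
    using that mset_eq_length[OF assms] permute_list_nth by metis
qed

text \<open>The inequality \<open>tangent\<close> says that \<open>- g x\<close> is a subgradient of \<open>f\<close> at \<open>x\<close>. With \<open>g \<ge> 0\<close> it makes \<open>f\<close>
  convex and decreasing and \<open>g\<close> decreasing, which is all that summation by parts needs.\<close>

lemma weak_majorization_weighted_sum:
  fixes f g :: "real \<Rightarrow> real"
  assumes len: "length \<alpha>1 = n" "length \<alpha>2 = n" "length x1 = n" "length x2 = n"
    and \<alpha>2: "\<forall>i<n. 0 < \<alpha>2 ! i"
    and x: "\<forall>i<n. x1 ! i \<in> S" "\<forall>i<n. x2 ! i \<in> S"
    and f: "\<And>x. x \<in> S \<Longrightarrow> 0 \<le> f x" and g: "\<And>x. x \<in> S \<Longrightarrow> 0 \<le> g x"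
    and tangent: "\<And>x y. x \<in> S \<Longrightarrow> y \<in> S \<Longrightarrow> f x - g x * (y - x) \<le> f y"
    and arr: "(\<alpha>2, x2) =\<^sup>a (increasing_arr \<alpha>2, decreasing_arr x2)"
    and maj: "\<alpha>1 \<prec>\<^sub>w \<alpha>2" "x1 \<prec>\<^sup>w x2"
  shows "(\<Sum>i<n. \<alpha>1 ! i * f (x1 ! i)) \<le> (\<Sum>i<n. \<alpha>2 ! i * f (x2 ! i))"
proof -
  define A1 A2 X1 X2 where defs: "A1 = rev (sort \<alpha>1)" "A2 = rev (sort \<alpha>2)"
    "X1 = sort x1" "X2 = sort x2"
  have lens: "length A1 = n" "length A2 = n" "length X1 = n" "length X2 = n"
    using len by (auto simp: defs)
  have A: "\<forall>k\<in>{1..n}. sum_list (take k A1) \<le> sum_list (take k A2)"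
    using maj(1) len unfolding weak_submajorized_def decreasing_arr_def defs by simp
  have A_le: "(\<Sum>i<k. A1 ! i) \<le> (\<Sum>i<k. A2 ! i)" if "k \<le> n" for k
    using bspec[OF A, of k] that lens by (cases "k = 0") (auto simp: sum_list_take_eq_sum)
  have X: "\<forall>k\<in>{1..n}. sum_list (take k X2) \<le> sum_list (take k X1)"
    using maj(2) len unfolding weak_supermajorized_def increasing_arr_def defs by simp
  have X_ge: "(\<Sum>i<k. X2 ! i) \<le> (\<Sum>i<k. X1 ! i)" if "k \<le> n" for k
    using bspec[OF X, of k] that lens by (cases "k = 0") (auto simp: sum_list_take_eq_sum)
  have A1_dec: "A1 ! j \<le> A1 ! i" and A2_dec: "A2 ! j \<le> A2 ! i"
    and X1_inc: "X1 ! i \<le> X1 ! j" and X2_inc: "X2 ! i \<le> X2 ! j" if "i \<le> j" "j < n" for i j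
    using that len by (auto simp: defs rev_nth intro!: sorted_nth_mono)
  have A2_pos: "0 < A2 ! i" if "i < n" for i
    using \<alpha>2 nth_mem[of i A2] that lens len by (auto simp: defs in_set_conv_nth)
  have X_S: "X1 ! i \<in> S" "X2 ! i \<in> S" if "i < n" for i
    using x nth_mem[of i X1] nth_mem[of i X2] that lens len by (auto simp: defs in_set_conv_nth)
  \<comment> \<open>The tangent is taken at the larger point \<open>y\<close>, where its slope
    \<open>- g y\<close> is not positive.\<close>
  have f_anti: "f y \<le> f x" if "x \<in> S" "y \<in> S" "x \<le> y" for x y
    using tangent[of y x] g[of y] mult_nonneg_nonneg[of "g y" "y - x"] that
    by (simp add: algebra_simps)
  have g_anti: "g y \<le> g x" if "x \<in> S" "y \<in> S" "x \<le> y" for x y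
  proof (cases "x = y")
    case False
    \<comment> \<open>Adding the tangent inequalities at \<open>x\<close> and at \<open>y\<close>
      cancels the values of \<open>f\<close>: subgradients are monotone.\<close>
    have "g y * (y - x) \<le> g x * (y - x)"
      using tangent[of x y] tangent[of y x] that by (simp add: algebra_simps)
    then show ?thesis using False that by simp
  qed simp
  \<comment> \<open>\<open>\<sigma>\<close> sorts \<open>x1\<close> increasingly and carries
    \<open>\<alpha>1\<close> along, since the pairing of \<open>\<alpha>1\<close> with
    \<open>x1\<close> is arbitrary and has to be kept.\<close>
  obtain \<sigma> where \<sigma>: "\<sigma> permutes {..<n}" "\<And>i. i < n \<Longrightarrow> X1 ! i = x1 ! \<sigma> i"
    using permutes_mset_eq[of X1 x1] lens by (auto simp: defs)
  obtain \<tau> where \<tau>: "\<tau> permutes {..<n}" "\<And>i. i < n \<Longrightarrow> \<alpha>1 ! i = A1 ! \<tau> i"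
    using permutes_mset_eq[of \<alpha>1 A1] len by (auto simp: defs)
  define A3 X3 where A3: "A3 = sort \<alpha>2" and X3: "X3 = rev (sort x2)"
  have lens3: "length A3 = n" "length X3 = n" using len by (auto simp: A3 X3)
  have "\<exists>\<pi>. \<pi> permutes {..<n} \<and> \<alpha>2 = permute_list \<pi> A3 \<and> x2 = permute_list \<pi> X3"
    using arr
    unfolding A3 X3 arrangement_eq_def increasing_arr_def decreasing_arr_def fst_conv snd_conv length_sort len
    by (rule conjunct2)
  then obtain \<pi> where \<pi>: "\<pi> permutes {..<n}" "\<alpha>2 = permute_list \<pi> A3" "x2 = permute_list \<pi> X3"
    by blast
  \<comment> \<open>The first \<open>k\<close> entries of the rearranged \<open>\<alpha>1\<close>
    are some \<open>k\<close> entries of \<open>A1\<close>, hence sum to at most the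
    \<open>k\<close> largest.\<close>
  have \<alpha>1_le: "(\<Sum>i<k. \<alpha>1 ! \<sigma> i) \<le> (\<Sum>i<k. A1 ! i)" if "k \<le> n" for k
  proof -
    have inj: "inj_on (\<tau> \<circ> \<sigma>) {..<k}"
      using permutes_inj[OF permutes_compose[OF \<sigma>(1) \<tau>(1)]] inj_on_subset by blast
    have "(\<Sum>i<k. \<alpha>1 ! \<sigma> i) = (\<Sum>i<k. A1 ! ((\<tau> \<circ> \<sigma>) i))"
      using that permutes_in_image[OF \<sigma>(1)] by (intro sum.cong) (auto simp: \<tau>(2))
    also have "\<dots> = sum ((!) A1) ((\<tau> \<circ> \<sigma>) ` {..<k})"
      unfolding sum.reindex[OF inj] by simp
    also have "\<dots> \<le> (\<Sum>i<k. A1 ! i)"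
    proof (rule sum_subset_le_initial_sum[where n = n])
      show "(\<tau> \<circ> \<sigma>) ` {..<k} \<subseteq> {..<n}"
        using that permutes_image[OF permutes_compose[OF \<sigma>(1) \<tau>(1)]]
          image_mono[of "{..<k}" "{..<n}" "\<tau> \<circ> \<sigma>"] by simp
      show "card ((\<tau> \<circ> \<sigma>) ` {..<k}) = k" unfolding card_image[OF inj] by simp
    qed (use A1_dec in blast)
    finally show ?thesis .
  qed
  have "(\<Sum>i<n. \<alpha>1 ! i * f (x1 ! i)) = (\<Sum>i<n. \<alpha>1 ! \<sigma> i * f (x1 ! \<sigma> i))"
    using sum.permute[OF \<sigma>(1), of "\<lambda>i. \<alpha>1 ! i * f (x1 ! i)"] by (simp add: o_def)
  also have "\<dots> = (\<Sum>i<n. f (X1 ! i) * \<alpha>1 ! \<sigma> i)"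
    by (intro sum.cong) (auto simp: \<sigma>(2))
  \<comment> \<open>First exchange: the coefficients. The weights \<open>f (X1 ! i)\<close>
    decrease, and the partial sums of the differences are controlled by submajorization.\<close>
  also have "\<dots> \<le> (\<Sum>i<n. f (X1 ! i) * A2 ! i)"
  proof -
    have "0 \<le> (\<Sum>i<n. f (X1 ! i) * (A2 ! i - \<alpha>1 ! \<sigma> i))"
    proof (rule sum_mult_nonneg_of_partial_sums)
      show "f (X1 ! j) \<le> f (X1 ! i)" if "i \<le> j" "j < n" for i j
        using that X1_inc X_S by (intro f_anti) auto
      show "0 \<le> (\<Sum>i<k. A2 ! i - \<alpha>1 ! \<sigma> i)" if "k \<le> n" for k
        using A_le[OF that] \<alpha>1_le[OF that] by (simp add: sum_subtractf)
    qed (use f X_S in auto)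
    then show ?thesis by (simp add: algebra_simps sum_subtractf)
  qed
  \<comment> \<open>Second exchange: the arguments. Now the decreasing positive \<open>A2\<close>
    serves as the weights.\<close>
  also have "\<dots> \<le> (\<Sum>i<n. f (X2 ! i) * A2 ! i)"
  proof -
    have "0 \<le> (\<Sum>i<n. (A2 ! i) * (f (X2 ! i) - f (X1 ! i)))"
    proof (rule sum_mult_nonneg_of_partial_sums)
      show "0 \<le> (\<Sum>i<k. f (X2 ! i) - f (X1 ! i))" if "k \<le> n" for k
      proof -
        \<comment> \<open>The tangent at \<open>X1 ! i\<close> bounds
          \<open>f (X2 ! i) - f (X1 ! i)\<close> below by
          \<open>g (X1 ! i) * (X1 ! i - X2 ! i)\<close>. A further Abel summation with the
          decreasing weights \<open>g (X1 ! i)\<close> reduces this to supermajorization.\<close>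
        have "0 \<le> (\<Sum>i<k. g (X1 ! i) * (X1 ! i - X2 ! i))"
        proof (rule sum_mult_nonneg_of_partial_sums)
          show "g (X1 ! j) \<le> g (X1 ! i)" if "i \<le> j" "j < k" for i j
            using that X1_inc X_S \<open>k \<le> n\<close> by (intro g_anti) auto
          show "0 \<le> (\<Sum>i<l. X1 ! i - X2 ! i)" if "l \<le> k" for l
            using X_ge[of l] that \<open>k \<le> n\<close> by (simp add: sum_subtractf)
        qed (use g X_S that in auto)
        also have "\<dots> \<le> (\<Sum>i<k. f (X2 ! i) - f (X1 ! i))"
          using tangent[OF X_S] that by (intro sum_mono) (fastforce simp: algebra_simps)
        finally show ?thesis .
      qed
    qed (use A2_dec A2_pos in \<open>auto intro: less_imp_le\<close>)
    then show ?thesis by (simp add: algebra_simps sum_subtractf)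
  qed
  \<comment> \<open>Reading the indices backwards turns the pairing (decreasing, increasing) into
    (increasing, decreasing), which by the arrangement hypothesis is the pairing of
    \<open>\<alpha>2\<close> with \<open>x2\<close> up to the single permutation
    \<open>\<pi>\<close>.\<close>
  also have "\<dots> = (\<Sum>i<n. A3 ! i * f (X3 ! i))"
    using len by (subst sum.nat_diff_reindex[symmetric])
      (auto simp: defs A3 X3 rev_nth intro!: sum.cong)
  also have "\<dots> = (\<Sum>i<n. A3 ! \<pi> i * f (X3 ! \<pi> i))"
    using sum.permute[OF \<pi>(1), of "\<lambda>i. A3 ! i * f (X3 ! i)"] by (simp add: o_def)
  also have "\<dots> = (\<Sum>i<n. \<alpha>2 ! i * f (x2 ! i))"
    using \<pi>(1) lens3 by (intro sum.cong) (auto simp: \<pi>(2,3) permute_list_nth)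
  finally show ?thesis .
qed

text \<open>Convexity of the power, by induction: multiplying the bound for \<open>k\<close> by
  \<open>b\<close> exceeds the bound for \<open>Suc k\<close> by
  \<open>k a^(k-1) (b - a)^2\<close>.\<close>

lemma power_ge_tangent:
  fixes a b :: real
  assumes "0 < a" "0 < b"
  shows "a ^ k + real k * a ^ (k - 1) * (b - a) \<le> b ^ k"
proof (induction k)
  case (Suc k)
  show ?case
  proof (cases k)
    case (Suc m)
    have "b * (a ^ k + real k * a ^ (k - 1) * (b - a)) - (a ^ Suc k + real (Suc k) * a ^ (Suc k - 1) * (b - a))
      = real k * a ^ m * (b - a) ^ 2"
      using Suc by (simp add: algebra_simps power2_eq_square)
    moreover have "\<dots> \<ge> 0" using assms by simp
    moreover have "b * (a ^ k + real k * a ^ (k - 1) * (b - a)) \<le> b * b ^ k"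
      using Suc.IH assms by (intro mult_left_mono) auto
    ultimately show ?thesis by simp
  qed simp
qed simp

text \<open>The scale \<open>m\<close> is 1 for the negative binomial case; for the gamma case it is
  large and \<open>x / m\<close> becomes a success probability. On \<open>{..<m}\<close> the base
  \<open>1 - x / m\<close> is positive, and \<open>g\<close> is minus the derivative of the
  power.\<close>

lemma weak_majorization_power_sum:
  assumes "length \<alpha>1 = n" "length \<alpha>2 = n" "length x1 = n" "length x2 = n"
    and "\<forall>i<n. 0 < \<alpha>2 ! i"
    and "0 < m" "\<forall>i<n. x1 ! i < m" "\<forall>i<n. x2 ! i < m"
    and "(\<alpha>2, x2) =\<^sup>a (increasing_arr \<alpha>2, decreasing_arr x2)"
    and "\<alpha>1 \<prec>\<^sub>w \<alpha>2" "x1 \<prec>\<^sup>w x2"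
  shows "(\<Sum>i<n. \<alpha>1 ! i * (1 - x1 ! i / m) ^ k) \<le> (\<Sum>i<n. \<alpha>2 ! i * (1 - x2 ! i / m) ^ k)"
proof (rule weak_majorization_weighted_sum[where S = "{..<m}"
      and g = "\<lambda>x. real k * (1 - x / m) ^ (k - 1) / m"])
  fix x y assume "x \<in> {..<m}" "y \<in> {..<m}"
  then show "(1 - x / m) ^ k - real k * (1 - x / m) ^ (k - 1) / m * (y - x) \<le> (1 - y / m) ^ k"
    using power_ge_tangent[of "1 - x / m" "1 - y / m" k] \<open>0 < m\<close>
    by (simp add: diff_divide_distrib algebra_simps)
qed (use assms in auto)

section \<open>The convolution order and characteristic functions\<close>

text \<open>The required space is the product of the law of \<open>X1\<close> and
  \<open>\<nu>\<close>, with the coordinates as variables. Independence makes the characteristic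
  function of the sum a product, and Levy's uniqueness theorem identifies its law.\<close>

lemma conv_leI_char:
  assumes "prob_space M1" "prob_space M2"
    and [measurable]: "X1 \<in> borel_measurable M1" "X2 \<in> borel_measurable M2"
    and \<nu>: "real_distribution \<nu>" "AE x in \<nu>. 0 \<le> x"
    and char_eq: "\<And>t. char (distr M2 borel X2) t = char (distr M1 borel X1) t * char \<nu> t"
  shows "conv_le M1 X1 M2 X2"
proof -
  interpret M1: prob_space M1 by fact
  interpret M2: prob_space M2 by fact
  define \<mu> where "\<mu> = distr M1 borel X1"
  interpret \<mu>: real_distribution \<mu> unfolding \<mu>_def by (rule M1.real_distribution_distr) simp
  interpret \<nu>: real_distribution \<nu> by fact
  interpret P: pair_prob_space \<mu> \<nu> ..
  \<comment> \<open>Truncation at 0 gives nonnegativity at every point, as \<open>conv_le\<close>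
    demands, and changes the second coordinate only on a null set.\<close>
  define Z where "Z = (\<lambda>\<omega>::real \<times> real. max 0 (snd \<omega>))"
  have Z_meas [measurable]: "Z \<in> borel_measurable (\<mu> \<Otimes>\<^sub>M \<nu>)" unfolding Z_def by measurable
  have fst_distr: "distr (\<mu> \<Otimes>\<^sub>M \<nu>) borel fst = \<mu>"
    using \<nu>.distr_pair_fst[of \<mu>] by (metis \<mu>.events_eq_borel distr_cong)
  have snd_distr: "distr (\<mu> \<Otimes>\<^sub>M \<nu>) \<nu> snd = \<nu>"
  proof (rule measure_eqI)
    fix A assume "A \<in> sets (distr (\<mu> \<Otimes>\<^sub>M \<nu>) \<nu> snd)"
    then have A: "A \<in> sets \<nu>" by simp
    have "snd -` A \<inter> space (\<mu> \<Otimes>\<^sub>M \<nu>) = space \<mu> \<times> A"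
      using sets.sets_into_space[OF A] by (auto simp: space_pair_measure)
    then show "emeasure (distr (\<mu> \<Otimes>\<^sub>M \<nu>) \<nu> snd) A = emeasure \<nu> A"
      using A \<mu>.emeasure_space_1 by (simp add: emeasure_distr \<nu>.emeasure_pair_measure_Times)
  qed simp
  have Z_distr: "distr (\<mu> \<Otimes>\<^sub>M \<nu>) borel Z = \<nu>"
  proof -
    have "distr (\<mu> \<Otimes>\<^sub>M \<nu>) borel Z = distr (distr (\<mu> \<Otimes>\<^sub>M \<nu>) \<nu> snd) borel (max 0)"
      by (subst distr_distr) (auto simp: Z_def o_def)
    also have "\<dots> = distr \<nu> borel (\<lambda>x. x)"
      unfolding snd_distr using \<nu>(2) by (intro distr_cong_AE) auto
    also have "\<dots> = \<nu>" by (rule distr_id2) simp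
    finally show ?thesis .
  qed
  have indep: "P.indep_var borel fst borel Z"
  proof -
    have *: "P.indep_var \<mu> fst \<nu> snd"
      unfolding P.indep_var_distribution_eq
    proof safe
      have "distr (\<mu> \<Otimes>\<^sub>M \<nu>) \<mu> fst = \<mu>" using fst_distr by (metis \<mu>.events_eq_borel distr_cong)
      then show "distr (\<mu> \<Otimes>\<^sub>M \<nu>) \<mu> fst \<Otimes>\<^sub>M distr (\<mu> \<Otimes>\<^sub>M \<nu>) \<nu> snd
          = distr (\<mu> \<Otimes>\<^sub>M \<nu>) (\<mu> \<Otimes>\<^sub>M \<nu>) (\<lambda>x. (fst x, snd x))"
        using snd_distr by (simp add: distr_id)
    qed
    have "P.indep_var borel ((\<lambda>x. x) \<circ> fst) borel (max 0 \<circ> snd)"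
      by (rule P.indep_var_compose[OF *]) auto
    then show ?thesis by (simp add: Z_def o_def)
  qed
  have "distr (\<mu> \<Otimes>\<^sub>M \<nu>) borel (\<lambda>\<omega>. fst \<omega> + Z \<omega>) = distr M2 borel X2"
  proof (rule Levy_uniqueness)
    show "real_distribution (distr (\<mu> \<Otimes>\<^sub>M \<nu>) borel (\<lambda>\<omega>. fst \<omega> + Z \<omega>))"
      by (rule P.real_distribution_distr) simp
    show "real_distribution (distr M2 borel X2)"
      by (rule M2.real_distribution_distr) simp
    show "char (distr (\<mu> \<Otimes>\<^sub>M \<nu>) borel (\<lambda>\<omega>. fst \<omega> + Z \<omega>)) = char (distr M2 borel X2)"
      by (rule ext) (simp add: P.char_distr_add[OF indep] fst_distr Z_distr char_eq[folded \<mu>_def])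
  qed
  moreover have "\<forall>\<omega>\<in>space (\<mu> \<Otimes>\<^sub>M \<nu>). 0 \<le> Z \<omega>" by (simp add: Z_def)
  ultimately show ?thesis
    unfolding conv_le_def using indep fst_distr P.prob_space_axioms \<mu>_def by blast
qed

section \<open>Negative binomial laws\<close>

text \<open>The characteristic function of the negative binomial law. Putting the factor
  \<open>p\<close> inside the power makes the later gamma limit a statement about the base
  alone.\<close>

definition negbin_char :: "real \<Rightarrow> real \<Rightarrow> real \<Rightarrow> complex" where
  "negbin_char \<alpha> p t = ((1 - of_real (1 - p) * iexp t) / of_real p) powr (- of_real \<alpha>)"

text \<open>The binomial series with exponent -\<alpha> at \<open>- z\<close>; the sign from
  negating the upper index cancels the one from \<open>- z\<close>.\<close>

lemma negbin_series:
  fixes z :: complex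
  assumes "norm z < 1"
  shows "(\<lambda>k. of_real ((real k + \<alpha> - 1) gchoose k) * z ^ k) sums (1 - z) powr (- of_real \<alpha>)"
proof -
  have "((- of_real \<alpha>) gchoose k) * (- z) ^ k = of_real ((real k + \<alpha> - 1) gchoose k) * z ^ k" for k
  proof -
    have "((- of_real \<alpha> :: complex) gchoose k) = of_real ((- \<alpha>) gchoose k)"
      by (simp add: gbinomial_prod_rev)
    also have "\<dots> = (- 1) ^ k * of_real ((real k + \<alpha> - 1) gchoose k)"
      by (subst gbinomial_minus) (simp add: add_ac)
    finally have "((- of_real \<alpha> :: complex) gchoose k) * (- z) ^ k
        = of_real ((real k + \<alpha> - 1) gchoose k) * ((- 1) ^ k * (- z) ^ k)"
      by (simp only: mult_ac)
    also have "(- 1) ^ k * (- z) ^ k = z ^ k"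
      by (simp flip: power_mult_distrib)
    finally show ?thesis .
  qed
  then show ?thesis
    using gen_binomial_complex[of "- z" "- of_real \<alpha>"] assms by simp
qed

lemma norm_negbin_arg:
  assumes "0 < p" "p < 1"
  shows "norm (complex_of_real (1 - p) * iexp t) < 1"
  using assms by (simp add: norm_mult del: of_real_diff)

definition negbin_exponent :: "real \<Rightarrow> real \<Rightarrow> real \<Rightarrow> complex" where
  "negbin_exponent \<alpha> p t = of_real \<alpha> * (of_real (ln p) - Ln (1 - of_real (1 - p) * iexp t))"

text \<open>Division by the positive real \<open>p\<close> does not change the argument, so the
  principal logarithm of the quotient splits without a branch correction.\<close>

lemma negbin_char_eq_exp:
  assumes p: "0 < p" "p < 1"
  shows "negbin_char \<alpha> p t = exp (negbin_exponent \<alpha> p t)"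
proof -
  define w where "w = of_real (1 - p) * iexp t"
  have w: "norm w < 1" using p unfolding w_def by (rule norm_negbin_arg)
  then have "1 - w \<noteq> 0" by auto
  then have Ln_eq: "Ln ((1 - w) / of_real p) = Ln (1 - w) - of_real (ln p)"
    using p Ln_divide_of_real[of p "1 - w"] by (simp add: Ln_of_real)
  have "negbin_char \<alpha> p t = exp (- of_real \<alpha> * Ln ((1 - w) / of_real p))"
    using p \<open>1 - w \<noteq> 0\<close> by (simp add: negbin_char_def powr_def w_def)
  also have "\<dots> = exp (of_real \<alpha> * (of_real (ln p) - Ln (1 - w)))"
    unfolding Ln_eq by (simp add: algebra_simps)
  finally show ?thesis unfolding w_def negbin_exponent_def .
qed

lemma negbin_char_sums:
  assumes p: "0 < p" "p < 1"
  shows "(\<lambda>k. of_real (negbin_prob \<alpha> p k) * iexp (t * real k)) sums negbin_char \<alpha> p t"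
proof -
  define w where "w = of_real (1 - p) * iexp t"
  have w: "norm w < 1" using p unfolding w_def by (rule norm_negbin_arg)
  have "of_real (negbin_prob \<alpha> p k) * iexp (t * real k)
      = of_real (p powr \<alpha>) * (of_real ((real k + \<alpha> - 1) gchoose k) * w ^ k)" for k
    by (simp add: negbin_prob_def w_def power_mult_distrib mult_ac flip: exp_of_nat_mult)
  moreover have "negbin_char \<alpha> p t = of_real (p powr \<alpha>) * (1 - w) powr (- of_real \<alpha>)"
  proof -
    have "1 - w \<noteq> 0" using w by auto
    then show ?thesis
      using p unfolding negbin_char_eq_exp[OF p] negbin_exponent_def w_def[symmetric]
      by (simp add: powr_def algebra_simps exp_diff exp_minus divide_inverse flip: exp_of_real)
  qed
  ultimately show ?thesis using sums_mult[OF negbin_series[OF w, of \<alpha>]] by simp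
qed

text \<open>The term \<open>k = 0\<close> vanishes because of \<open>x / 0 = 0\<close>.\<close>

lemma negbin_exponent_sums:
  assumes p: "0 < p" "p < 1"
  shows "(\<lambda>k. of_real (\<alpha> * (1 - p) ^ k / real k) * (iexp (t * real k) - 1))
    sums negbin_exponent \<alpha> p t"
proof -
  define w where "w = of_real (1 - p) * iexp t"
  have w: "norm w < 1" using p unfolding w_def by (rule norm_negbin_arg)
  have 1: "(\<lambda>k. - (w ^ k / of_nat k)) sums Ln (1 - w)"
    using Ln_series'[of "- w"] w by simp
  have "(\<lambda>k. - ((1 - p) ^ k / real k)) sums ln p"
    using ln_series'[of "p - 1"] p by simp
  then have 2: "(\<lambda>k. complex_of_real (- ((1 - p) ^ k / real k))) sums of_real (ln p)"
    by (rule sums_of_real)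
  have "(\<lambda>k. of_real \<alpha> * (complex_of_real (- ((1 - p) ^ k / real k)) - (- (w ^ k / of_nat k))))
      sums (of_real \<alpha> * (of_real (ln p) - Ln (1 - w)))"
    by (intro sums_mult sums_diff 1 2)
  also have "(\<lambda>k. of_real \<alpha> * (complex_of_real (- ((1 - p) ^ k / real k)) - (- (w ^ k / of_nat k))))
     = (\<lambda>k. of_real (\<alpha> * (1 - p) ^ k / real k) * (iexp (t * real k) - 1))"
    by (rule ext) (simp add: w_def power_mult_distrib mult_ac diff_divide_distrib algebra_simps
        del: of_real_diff flip: exp_of_nat_mult)
  finally show ?thesis unfolding negbin_exponent_def w_def .
qed

section \<open>The negative binomial law as a law on the natural numbers\<close>

lemma negbin_prob_nonneg:
  assumes "0 < \<alpha>" "0 < p" "p < 1"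
  shows "0 \<le> negbin_prob \<alpha> p k"
proof -
  have "0 \<le> (real k + \<alpha> - 1) gchoose k"
    unfolding gbinomial_pochhammer' using assms by (auto intro!: pochhammer_nonneg divide_nonneg_pos)
  then show ?thesis using assms by (simp add: negbin_prob_def)
qed

lemma pmf_nat_expectation_sums:
  fixes f :: "nat \<Rightarrow> complex"
  assumes "\<And>k. norm (f k) \<le> B"
  shows "(\<lambda>k. of_real (pmf p k) * f k) sums (\<integral>k. f k \<partial>measure_pmf p)"
proof -
  have "integrable (measure_pmf p) f"
    using assms by (intro measure_pmf.integrable_const_bound[where B = B]) auto
  then have "integrable (count_space UNIV) (\<lambda>k. pmf p k *\<^sub>R f k)"
    unfolding measure_pmf_eq_density by (subst (asm) integrable_density) auto
  from sums_integral_count_space_nat[OF this]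
  have "(\<lambda>k. pmf p k *\<^sub>R f k) sums (\<integral>k. pmf p k *\<^sub>R f k \<partial>count_space UNIV)" .
  also have "(\<integral>k. pmf p k *\<^sub>R f k \<partial>count_space UNIV) = (\<integral>k. f k \<partial>measure_pmf p)"
    unfolding measure_pmf_eq_density by (subst integral_density) auto
  finally show ?thesis by (simp add: scaleR_conv_of_real)
qed

lemma pmf_nat_of_sums:
  fixes f :: "nat \<Rightarrow> real"
  assumes "\<And>k. 0 \<le> f k" "f sums 1"
  obtains p where "\<And>k. pmf p k = f k"
proof -
  have "(\<integral>\<^sup>+ k. ennreal (f k) \<partial>count_space UNIV) = 1"
    using assms by (simp add: nn_integral_count_space_nat suminf_ennreal_eq flip: sums_unique)
  then have "\<And>k. pmf (embed_pmf f) k = f k" using assms by (intro pmf_embed_pmf) auto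
  then show ?thesis by (rule that)
qed

text \<open>\<open>X\<close> is real-valued and only its masses at naturals are prescribed. As these
  sum to one, \<open>X\<close> agrees almost surely with a natural-valued \<open>Y\<close>, whose
  law is a \<open>pmf\<close>, and the expectation becomes the series of
  \<open>negbin_char_sums\<close>.\<close>

lemma char_negbin_distributed:
  assumes "prob_space M" "negbin_distributed M X \<alpha> p" "0 < \<alpha>" and p: "0 < p" "p < 1"
  shows "char (distr M borel X) t = negbin_char \<alpha> p t"
proof -
  interpret prob_space M by fact
  have X [measurable]: "X \<in> borel_measurable M"
    and prob_X: "\<And>k. prob {\<omega> \<in> space M. X \<omega> = real k} = negbin_prob \<alpha> p k"
    using assms(2) by (auto simp: negbin_distributed_def)
  \<comment> \<open>That the weights sum to one is read off from the series of the characteristic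
    function at \<open>t = 0\<close>.\<close>
  have "negbin_char \<alpha> p 0 = 1" using p by (simp add: negbin_char_def)
  with negbin_char_sums[OF p, of \<alpha> 0]
  have "(\<lambda>k. complex_of_real (negbin_prob \<alpha> p k)) sums of_real 1" by simp
  then have sums1: "negbin_prob \<alpha> p sums 1" unfolding sums_of_real_iff .
  then obtain P where P: "\<And>k. pmf P k = negbin_prob \<alpha> p k"
    using pmf_nat_of_sums negbin_prob_nonneg[OF assms(3) p] by metis
  have AE_nat: "AE \<omega> in M. X \<omega> = real (nat \<lfloor>X \<omega>\<rfloor>)"
  proof -
    have "(\<lambda>k. prob {\<omega> \<in> space M. X \<omega> = real k}) sums prob (\<Union>k. {\<omega> \<in> space M. X \<omega> = real k})"
      by (rule finite_measure_UNION) (auto simp: disjoint_family_on_def)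
    with sums1 have "prob (\<Union>k. {\<omega> \<in> space M. X \<omega> = real k}) = 1"
      unfolding prob_X by (rule sums_unique2[rotated])
    then have "AE \<omega> in M. \<omega> \<in> (\<Union>k. {\<omega> \<in> space M. X \<omega> = real k})"
      by (subst (asm) prob_eq_1) auto
    then show ?thesis by eventually_elim auto
  qed
  define Y where "Y \<omega> = nat \<lfloor>X \<omega>\<rfloor>" for \<omega>
  have Y [measurable]: "Y \<in> measurable M (count_space UNIV)" unfolding Y_def by measurable
  have distr_Y: "distr M (count_space UNIV) Y = measure_pmf P"
  proof (rule measure_eqI_countable[where A = UNIV])
    fix k :: nat
    have "emeasure M (Y -` {k} \<inter> space M) = emeasure M {\<omega> \<in> space M. X \<omega> = real k}"
      using AE_nat by (intro emeasure_eq_AE) (auto simp: Y_def)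
    then show "emeasure (distr M (count_space UNIV) Y) {k} = emeasure (measure_pmf P) {k}"
      by (simp add: emeasure_distr emeasure_eq_measure prob_X P emeasure_pmf_single)
  qed auto
  have "char (distr M borel X) t = (\<integral>\<omega>. iexp (t * X \<omega>) \<partial>M)"
    unfolding char_def by (subst integral_distr) auto
  also have "\<dots> = (\<integral>\<omega>. iexp (t * real (Y \<omega>)) \<partial>M)"
  proof (rule integral_cong_AE)
    show "AE \<omega> in M. iexp (t * X \<omega>) = iexp (t * real (Y \<omega>))"
      using AE_nat unfolding Y_def by eventually_elim metis
  qed auto
  also have "\<dots> = (\<integral>k. iexp (t * real k) \<partial>measure_pmf P)"
    unfolding distr_Y[symmetric] by (subst integral_distr) auto
  also have "\<dots> = negbin_char \<alpha> p t"
    using negbin_char_sums[OF p, of \<alpha> t] pmf_nat_expectation_sums[of "\<lambda>k. iexp (t * real k)" 1 P]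
    by (intro sums_unique2) (auto simp: P)
  finally show ?thesis .
qed

section \<open>Compound Poisson laws\<close>

text \<open>The law of total expectation, applied separately to the bounded real and imaginary
  parts.\<close>

lemma integral_bind_pmf_bounded:
  fixes f :: "'b \<Rightarrow> complex"
  assumes "\<And>x. norm (f x) \<le> B"
  shows "(\<integral>x. f x \<partial>measure_pmf (bind_pmf M N)) = (\<integral>x. \<integral>y. f y \<partial>measure_pmf (N x) \<partial>measure_pmf M)"
proof -
  have real: "(\<integral>x. g x \<partial>measure_pmf (bind_pmf M N)) = (\<integral>x. \<integral>y. g y \<partial>measure_pmf (N x) \<partial>measure_pmf M)"
    if "\<And>x. \<bar>g x\<bar> \<le> B" for g :: "'b \<Rightarrow> real"
    unfolding measure_pmf_bind
    using that by (intro integral_bind[where K = "count_space UNIV" and B = B and B' = 1])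
      (auto intro: measure_pmf.finite_measure_axioms measure_pmf.subprob_space_axioms
        measure_pmf.subprob_emeasure_le_1 simp: space_subprob_algebra)
  have int: "integrable (measure_pmf Q) f" for Q
    using assms by (intro measure_pmf.integrable_const_bound[where B = B]) auto
  have "norm (\<integral>y. f y \<partial>measure_pmf (N x)) \<le> B" for x
  proof -
    have "norm (\<integral>y. f y \<partial>measure_pmf (N x)) \<le> (\<integral>y. norm (f y) \<partial>measure_pmf (N x))"
      by (rule integral_norm_bound)
    also have "\<dots> \<le> (\<integral>y. B \<partial>measure_pmf (N x))"
      using int assms by (intro integral_mono) auto
    finally show ?thesis by (simp add: measure_pmf.prob_space)
  qed
  then have int2: "integrable (measure_pmf M) (\<lambda>x. \<integral>y. f y \<partial>measure_pmf (N x))"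
    by (intro measure_pmf.integrable_const_bound[where B = B]) auto
  show ?thesis
  proof (rule complex_eqI)
    show "Re (\<integral>x. f x \<partial>measure_pmf (bind_pmf M N)) = Re (\<integral>x. \<integral>y. f y \<partial>measure_pmf (N x) \<partial>measure_pmf M)"
      using real[of "\<lambda>x. Re (f x)"] order_trans[OF abs_Re_le_cmod assms]
      by (simp add: int int2)
    show "Im (\<integral>x. f x \<partial>measure_pmf (bind_pmf M N)) = Im (\<integral>x. \<integral>y. f y \<partial>measure_pmf (N x) \<partial>measure_pmf M)"
      using real[of "\<lambda>x. Im (f x)"] order_trans[OF abs_Im_le_cmod assms]
      by (simp add: int int2)
  qed
qed

text \<open>The \<open>n\<close>-fold convolution power of \<open>J\<close>.\<close>

definition iid_sum_pmf :: "nat pmf \<Rightarrow> nat \<Rightarrow> nat pmf" where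
  "iid_sum_pmf J n = ((\<lambda>Q. bind_pmf J (\<lambda>j. map_pmf ((+) j) Q)) ^^ n) (return_pmf 0)"

lemma iid_sum_pmf_char:
  "(\<integral>k. iexp (t * real k) \<partial>measure_pmf (iid_sum_pmf J n)) = (\<integral>k. iexp (t * real k) \<partial>measure_pmf J) ^ n"
proof (induction n)
  case 0
  then show ?case by (simp add: iid_sum_pmf_def return_pmf.rep_eq integral_return)
next
  case (Suc n)
  have "(\<integral>k. iexp (t * real k) \<partial>measure_pmf (iid_sum_pmf J (Suc n)))
      = (\<integral>j. \<integral>k. iexp (t * real (j + k)) \<partial>measure_pmf (iid_sum_pmf J n) \<partial>measure_pmf J)"
    unfolding iid_sum_pmf_def funpow.simps o_apply
    by (subst integral_bind_pmf_bounded[where B = 1]) (auto simp: map_pmf_rep_eq integral_distr)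
  also have "\<dots> = (\<integral>j. iexp (t * real j) * (\<integral>k. iexp (t * real k) \<partial>measure_pmf (iid_sum_pmf J n)) \<partial>measure_pmf J)"
    by (simp add: distrib_left exp_add)
  also have "\<dots> = (\<integral>k. iexp (t * real k) \<partial>measure_pmf J) * (\<integral>k. iexp (t * real k) \<partial>measure_pmf (iid_sum_pmf J n))"
    by simp
  also have "\<dots> = (\<integral>k. iexp (t * real k) \<partial>measure_pmf J) ^ Suc n"
    unfolding Suc.IH by simp
  finally show ?case .
qed

text \<open>Stated with the nonnegative integral, so that no integrability of \<open>J\<close> has
  to be shown.\<close>

lemma iid_sum_pmf_mean:
  "(\<integral>\<^sup>+k. real k \<partial>measure_pmf (iid_sum_pmf J n)) = of_nat n * (\<integral>\<^sup>+k. real k \<partial>measure_pmf J)"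
proof (induction n)
  case 0
  then show ?case by (simp add: iid_sum_pmf_def)
next
  case (Suc n)
  have "(\<integral>\<^sup>+k. real k \<partial>measure_pmf (iid_sum_pmf J (Suc n)))
      = (\<integral>\<^sup>+j. \<integral>\<^sup>+k. real (j + k) \<partial>measure_pmf (iid_sum_pmf J n) \<partial>measure_pmf J)"
    unfolding iid_sum_pmf_def funpow.simps o_apply by simp
  also have "\<dots> = (\<integral>\<^sup>+k. real k \<partial>measure_pmf J) + (\<integral>\<^sup>+k. real k \<partial>measure_pmf (iid_sum_pmf J n))"
    by (simp add: nn_integral_add measure_pmf.emeasure_space_1)
  finally show ?case by (simp add: Suc.IH algebra_simps)
qed

lemma nn_integral_pmf_nat_sums:
  assumes "\<And>k. 0 \<le> f k" "(\<lambda>k. pmf p k * f k) sums s"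
  shows "(\<integral>\<^sup>+k. f k \<partial>measure_pmf p) = ennreal s"
proof -
  have "(\<integral>\<^sup>+k. f k \<partial>measure_pmf p) = (\<integral>\<^sup>+k. ennreal (pmf p k * f k) \<partial>count_space UNIV)"
    unfolding measure_pmf_eq_density
    by (subst nn_integral_density) (auto simp: ennreal_mult' simp del: pmf_poisson)
  then show ?thesis
    using assms by (simp add: nn_integral_count_space_nat suminf_ennreal_eq flip: sums_unique)
qed

lemma poisson_mean:
  assumes "0 < r"
  shows "(\<integral>\<^sup>+k. of_nat k \<partial>measure_pmf (poisson_pmf r)) = ennreal r"
proof -
  have "(\<lambda>k. r * exp (- r) * (r ^ k /\<^sub>R fact k)) sums (r * exp (- r) * exp r)"
    by (intro sums_mult exp_converges)
  \<comment> \<open>Weighting by \<open>k\<close> shifts the Poisson weights by one index and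
    produces the factor \<open>r\<close>; the lost term at 0 is zero.\<close>
  moreover have "r * exp (- r) * (r ^ k /\<^sub>R fact k) = pmf (poisson_pmf r) (Suc k) * real (Suc k)" for k
    using assms by (simp add: fact_Suc field_simps del: of_nat_Suc)
  ultimately have "(\<lambda>k. pmf (poisson_pmf r) (Suc k) * real (Suc k)) sums r"
    using exp_minus_inverse[of r] by (simp only: mult.assoc mult.commute[of "exp (- r)"] mult_1_right)
  then have "(\<lambda>k. pmf (poisson_pmf r) k * real k) sums r"
    by (subst (asm) sums_Suc_iff) simp
  from nn_integral_pmf_nat_sums[OF _ this] show ?thesis
    by (simp add: ennreal_of_nat_eq_real_of_nat)
qed

text \<open>\<open>c\<close> is the Levy measure. Its total mass \<open>r\<close> is finite because
  \<open>c k\<close> is at most \<open>k * c k\<close>, so a Poisson(\<open>r\<close>) number of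
  independent jumps with law \<open>c / r\<close> can be summed. The mean is recorded because it
  later yields tightness.\<close>

lemma compound_poisson_pmf:
  fixes c :: "nat \<Rightarrow> real"
  assumes c: "\<And>k. 0 \<le> c k" "c 0 = 0" and mean: "(\<lambda>k. real k * c k) sums S"
  obtains Z :: "nat pmf"
  where "\<And>t s. (\<lambda>k. of_real (c k) * (iexp (t * real k) - 1)) sums s
      \<Longrightarrow> (\<integral>k. iexp (t * real k) \<partial>measure_pmf Z) = exp s"
    and "(\<integral>\<^sup>+k. real k \<partial>measure_pmf Z) = ennreal S"
proof -
  have le: "c k \<le> real k * c k" for k
    using c mult_right_mono[of 1 "real k" "c k"] by (cases "k = 0") auto
  then have "summable c"
    using c by (intro summable_comparison_test'[OF sums_summable[OF mean], of 0]) auto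
  define r where "r = suminf c"
  have sums_r: "c sums r" unfolding r_def using \<open>summable c\<close> by (rule summable_sums)
  have "0 \<le> r" unfolding r_def using \<open>summable c\<close> c by (intro suminf_nonneg) auto
  show thesis
  proof (cases "r = 0")
    \<comment> \<open>With no jumps at all there is no jump law to normalize, and \<open>Z\<close>
      is the constant 0.\<close>
    case True
    then have c0: "c k = 0" for k
      using suminf_eq_zero_iff[OF \<open>summable c\<close>] c by (simp add: r_def)
    then have "S = 0" using mean sums_unique2[OF mean, of 0] by simp
    show thesis
    proof (rule that[of "return_pmf 0"])
      fix t s assume "(\<lambda>k. of_real (c k) * (iexp (t * real k) - 1)) sums s"
      then have "s = 0" using c0 sums_unique2[of "\<lambda>_. 0" s 0] by simp
      then show "(\<integral>k. iexp (t * real k) \<partial>measure_pmf (return_pmf 0)) = exp s"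
        by (simp add: return_pmf.rep_eq integral_return)
    qed (simp add: \<open>S = 0\<close>)
  next
    case False
    then have r: "0 < r" using \<open>0 \<le> r\<close> by simp
    have "(\<lambda>k. c k / r) sums 1" using sums_divide[OF sums_r, of r] r by simp
    then obtain J where J: "\<And>k. pmf J k = c k / r"
      using pmf_nat_of_sums[of "\<lambda>k. c k / r"] c r by auto
    have mean_J: "(\<integral>\<^sup>+k. real k \<partial>measure_pmf J) = ennreal (S / r)"
      using sums_divide[OF mean, of r] r
      by (intro nn_integral_pmf_nat_sums) (auto simp: J mult_ac)
    show thesis
    proof (rule that[of "bind_pmf (poisson_pmf r) (iid_sum_pmf J)"])
      fix t s assume s: "(\<lambda>k. of_real (c k) * (iexp (t * real k) - 1)) sums s"
      define \<phi> where "\<phi> = (\<integral>k. iexp (t * real k) \<partial>measure_pmf J)"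
      have "(\<lambda>k. of_real (c k / r) * iexp (t * real k)) sums \<phi>"
        using pmf_nat_expectation_sums[of "\<lambda>k. iexp (t * real k)" 1 J] by (simp add: \<phi>_def J)
      \<comment> \<open>Subtracting the total mass from \<open>r\<close> times the jump transform
        identifies the exponent as \<open>s = r * \<phi> - r\<close>.\<close>
      from sums_diff[OF sums_mult[OF this, of "of_real r"] sums_of_real[OF sums_r]]
      have "(\<lambda>k. of_real (c k) * (iexp (t * real k) - 1)) sums (of_real r * \<phi> - of_real r)"
        using r by (simp add: algebra_simps)
      then have s_eq: "s = of_real r * \<phi> - of_real r" using s sums_unique2 by blast
      have "norm \<phi> \<le> 1"
        using integral_norm_bound[of "measure_pmf J" "\<lambda>k. iexp (t * real k)"]
        by (simp add: \<phi>_def measure_pmf.prob_space)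
      then have "norm (\<phi> ^ n) \<le> 1" for n by (simp add: norm_power power_le_one)
      then have "(\<lambda>n. of_real (pmf (poisson_pmf r) n) * \<phi> ^ n) sums (\<integral>n. \<phi> ^ n \<partial>measure_pmf (poisson_pmf r))"
        by (rule pmf_nat_expectation_sums)
      \<comment> \<open>Conditioning on the number \<open>n\<close> of jumps gives \<phi>^n, and its
        Poisson average is the exponential series with value
        \<open>exp (r * \<phi> - r)\<close>.\<close>
      moreover have "(\<lambda>n. of_real (exp (- r)) * ((of_real r * \<phi>) ^ n /\<^sub>R fact n)) sums
          (of_real (exp (- r)) * exp (of_real r * \<phi>))"
        by (intro sums_mult exp_converges)
      then have "(\<lambda>n. of_real (pmf (poisson_pmf r) n) * \<phi> ^ n) sums exp s"
        using r unfolding s_eq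
        by (simp add: exp_diff exp_minus exp_of_real power_mult_distrib field_simps scaleR_conv_of_real)
      moreover have "(\<integral>k. iexp (t * real k) \<partial>measure_pmf (bind_pmf (poisson_pmf r) (iid_sum_pmf J)))
          = (\<integral>n. \<phi> ^ n \<partial>measure_pmf (poisson_pmf r))"
        unfolding iid_sum_pmf_char[symmetric] \<phi>_def
        by (rule integral_bind_pmf_bounded[where B = 1]) simp
      ultimately show "(\<integral>k. iexp (t * real k) \<partial>measure_pmf (bind_pmf (poisson_pmf r) (iid_sum_pmf J))) = exp s"
        using sums_unique2 by metis
    next
      show "(\<integral>\<^sup>+k. real k \<partial>measure_pmf (bind_pmf (poisson_pmf r) (iid_sum_pmf J))) = ennreal S"
        using r by (simp add: iid_sum_pmf_mean mean_J nn_integral_multc poisson_mean flip: ennreal_mult')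
    qed
  qed
qed

text \<open>Both products are exponentials of Levy sums, so their quotient has the weights
  \<open>c = D2 - D1\<close>, which \<open>le\<close> makes nonnegative. The mean bound depends only
  on the second family.\<close>

lemma negbin_char_quotient:
  fixes \<alpha>1 \<alpha>2 p1 p2 :: "nat \<Rightarrow> real"
  assumes p1: "\<And>i. i < n \<Longrightarrow> 0 < p1 i \<and> p1 i < 1" and p2: "\<And>i. i < n \<Longrightarrow> 0 < p2 i \<and> p2 i < 1"
    and \<alpha>: "\<And>i. i < n \<Longrightarrow> 0 < \<alpha>1 i" "\<And>i. i < n \<Longrightarrow> 0 < \<alpha>2 i"
    and le: "\<And>k. (\<Sum>i<n. \<alpha>1 i * (1 - p1 i) ^ k) \<le> (\<Sum>i<n. \<alpha>2 i * (1 - p2 i) ^ k)"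
  obtains Z :: "nat pmf"
  where "\<And>t. (\<Prod>i<n. negbin_char (\<alpha>2 i) (p2 i) t)
      = (\<Prod>i<n. negbin_char (\<alpha>1 i) (p1 i) t) * (\<integral>k. iexp (t * real k) \<partial>measure_pmf Z)"
    and "(\<integral>\<^sup>+k. real k \<partial>measure_pmf Z) \<le> ennreal (\<Sum>i<n. \<alpha>2 i / p2 i)"
proof -
  define D1 where "D1 k = (\<Sum>i<n. \<alpha>1 i * (1 - p1 i) ^ k / real k)" for k
  define D2 where "D2 k = (\<Sum>i<n. \<alpha>2 i * (1 - p2 i) ^ k / real k)" for k
  define c where "c k = D2 k - D1 k" for k
  have "D1 k \<le> D2 k" for k
    unfolding D1_def D2_def using le by (auto simp: divide_right_mono simp flip: sum_divide_distrib)
  then have c: "0 \<le> c k" for k by (simp add: c_def)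
  have geo: "(\<lambda>k. \<Sum>i<n. \<alpha>2 i * (1 - p2 i) ^ k) sums (\<Sum>i<n. \<alpha>2 i / p2 i)"
  proof (rule sums_sum)
    fix i assume "i \<in> {..<n}"
    then show "(\<lambda>k. \<alpha>2 i * (1 - p2 i) ^ k) sums (\<alpha>2 i / p2 i)"
      using sums_mult[OF geometric_sums[of "1 - p2 i"], of "\<alpha>2 i"] p2[of i] by simp
  qed
  \<comment> \<open>The subtracted sum is dropped. At \<open>k = 0\<close> the left side is 0, and
    keeping that term on the right makes the geometric series sum to the plain \<alpha>/p.\<close>
  have kc: "real k * c k \<le> (\<Sum>i<n. \<alpha>2 i * (1 - p2 i) ^ k)" for k
  proof -
    have "0 \<le> (\<Sum>i<n. \<alpha>1 i * (1 - p1 i) ^ k)" "0 \<le> (\<Sum>i<n. \<alpha>2 i * (1 - p2 i) ^ k)"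
      using \<alpha> p1 p2 by (auto intro!: sum_nonneg mult_nonneg_nonneg less_imp_le[OF \<alpha>(1)] less_imp_le[OF \<alpha>(2)]
          simp: less_imp_le)
    then show ?thesis
      by (cases "k = 0") (auto simp: c_def D1_def D2_def right_diff_distrib simp flip: sum_divide_distrib)
  qed
  have summ: "summable (\<lambda>k. real k * c k)"
    using kc c by (intro summable_comparison_test'[OF sums_summable[OF geo], of 0]) auto
  obtain Z where Z: "\<And>t s. (\<lambda>k. of_real (c k) * (iexp (t * real k) - 1)) sums s
      \<Longrightarrow> (\<integral>k. iexp (t * real k) \<partial>measure_pmf Z) = exp s"
    and Z_mean: "(\<integral>\<^sup>+k. real k \<partial>measure_pmf Z) = ennreal (\<Sum>k. real k * c k)"
    using compound_poisson_pmf[OF c _ summable_sums[OF summ]] by (auto simp: c_def D1_def D2_def)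
  show thesis
  proof (rule that[of Z])
    fix t
    define S1 S2 where S_def: "S1 i = negbin_exponent (\<alpha>1 i) (p1 i) t"
      "S2 i = negbin_exponent (\<alpha>2 i) (p2 i) t" for i
    have "(\<lambda>k. (\<Sum>i<n. of_real (\<alpha>2 i * (1 - p2 i) ^ k / real k) * (iexp (t * real k) - 1))
        - (\<Sum>i<n. of_real (\<alpha>1 i * (1 - p1 i) ^ k / real k) * (iexp (t * real k) - 1)))
      sums (sum S2 {..<n} - sum S1 {..<n})"
      unfolding S_def using p1 p2 by (intro sums_diff sums_sum negbin_exponent_sums) auto
    then have "(\<lambda>k. of_real (c k) * (iexp (t * real k) - 1)) sums (sum S2 {..<n} - sum S1 {..<n})"
      unfolding c_def D1_def D2_def by (simp only: of_real_diff of_real_sum sum_distrib_right left_diff_distrib)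
    from Z[OF this] have "(\<integral>k. iexp (t * real k) \<partial>measure_pmf Z)
        = exp (sum S2 {..<n}) / exp (sum S1 {..<n})"
      unfolding exp_diff .
    moreover have "(\<Prod>i<n. negbin_char (\<alpha>1 i) (p1 i) t) = exp (sum S1 {..<n})"
        "(\<Prod>i<n. negbin_char (\<alpha>2 i) (p2 i) t) = exp (sum S2 {..<n})"
      unfolding exp_sum[OF finite_lessThan] S_def using p1 p2
      by (auto intro!: prod.cong negbin_char_eq_exp)
    ultimately show "(\<Prod>i<n. negbin_char (\<alpha>2 i) (p2 i) t)
      = (\<Prod>i<n. negbin_char (\<alpha>1 i) (p1 i) t) * (\<integral>k. iexp (t * real k) \<partial>measure_pmf Z)"
      by (metis exp_not_eq_zero nonzero_eq_divide_eq mult.commute)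
  next
    show "(\<integral>\<^sup>+k. real k \<partial>measure_pmf Z) \<le> ennreal (\<Sum>i<n. \<alpha>2 i / p2 i)"
      unfolding Z_mean using suminf_le[OF kc summ sums_summable[OF geo]] sums_unique[OF geo]
      by (intro ennreal_leI) simp
  qed
qed

section \<open>The characteristic function of the gamma law\<close>

lemma gamma_density_nonneg: "0 < \<alpha> \<Longrightarrow> 0 \<le> gamma_density \<alpha> \<beta> x"
  by (simp add: gamma_density_def)

lemma gamma_density_measurable [measurable]: "gamma_density \<alpha> \<beta> \<in> borel_measurable borel"
  unfolding gamma_density_def [abs_def] by measurable

lemma gamma_density_nonpos: "x \<le> 0 \<Longrightarrow> gamma_density \<alpha> \<beta> x = 0"
  by (cases "x = 0") (simp_all add: gamma_density_def)

lemma Gamma_real_plus1: "0 < \<alpha> \<Longrightarrow> Gamma (\<alpha> + 1) = \<alpha> * Gamma (\<alpha> :: real)"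
  by (intro Gamma_plus1) (auto simp: nonpos_Ints_def)

text \<open>Size biasing raises the shape by one. Thus differentiating the Fourier integral in its
  frequency amounts to changing \<alpha>.\<close>

lemma gamma_density_mult:
  assumes "0 < \<alpha>" "0 < \<beta>"
  shows "x * gamma_density \<alpha> \<beta> x = \<alpha> / \<beta> * gamma_density (\<alpha> + 1) \<beta> x"
proof (cases "x \<le> 0")
  case False
  have "Gamma \<alpha> \<noteq> 0" using Gamma_real_pos[OF assms(1)] by linarith
  moreover have "x powr \<alpha> = x * x powr (\<alpha> - 1)" "\<beta> powr (\<alpha> + 1) = \<beta> * \<beta> powr \<alpha>"
    using False assms powr_mult_base[of x "\<alpha> - 1"] powr_mult_base[of \<beta> \<alpha>] by (auto simp: add_ac)
  ultimately show ?thesis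
    using assms False by (simp add: gamma_density_def Gamma_real_plus1 divide_simps)
qed (simp add: gamma_density_nonpos)

text \<open>Euler's integral for \<open>Gamma\<close> under the substitution
  \<open>t = \<beta> * x\<close>.\<close>

lemma nn_integral_gamma_density:
  assumes "0 < \<alpha>" "0 < \<beta>"
  shows "(\<integral>\<^sup>+x. ennreal (gamma_density \<alpha> \<beta> x) \<partial>lborel) = 1"
proof -
  have pos: "Gamma \<alpha> > 0" and nz: "Gamma \<alpha> \<noteq> 0" using Gamma_real_pos[OF assms(1)] by linarith+
  have eq: "\<beta> * (indicator {0..} (\<beta> * x) * (\<beta> * x) powr (\<alpha> - 1) / exp (\<beta> * x))
      = Gamma \<alpha> * gamma_density \<alpha> \<beta> x" for x
  proof (cases "x \<le> 0")
    case True
    then show ?thesis using assms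
      by (cases "x = 0") (auto simp: gamma_density_nonpos indicator_def zero_le_mult_iff)
  next
    case False
    have "\<beta> powr \<alpha> = \<beta> * \<beta> powr (\<alpha> - 1)" using assms powr_mult_base[of \<beta> "\<alpha> - 1"] by simp
    then show ?thesis using False pos assms
      by (simp add: gamma_density_def powr_mult exp_minus nz divide_simps)
  qed
  have "ennreal (Gamma \<alpha>) = (\<integral>\<^sup>+t. ennreal (indicator {0..} t * t powr (\<alpha> - 1) / exp t) \<partial>lborel)"
    by (rule Gamma_conv_nn_integral_real) fact
  also have "\<dots> = ennreal \<beta> *
      (\<integral>\<^sup>+x. ennreal (indicator {0..} (\<beta> * x) * (\<beta> * x) powr (\<alpha> - 1) / exp (\<beta> * x)) \<partial>lborel)"
    using assms by (subst nn_integral_real_affine[where c = \<beta> and t = 0]) auto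
  also have "\<dots> = (\<integral>\<^sup>+x. ennreal (Gamma \<alpha>) * ennreal (gamma_density \<alpha> \<beta> x) \<partial>lborel)"
    using assms pos by (subst nn_integral_cmult[symmetric])
      (auto simp only: eq ennreal_mult'[symmetric] less_imp_le intro!: nn_integral_cong, measurable)
  also have "\<dots> = ennreal (Gamma \<alpha>) * (\<integral>\<^sup>+x. ennreal (gamma_density \<alpha> \<beta> x) \<partial>lborel)"
    by (rule nn_integral_cmult) simp
  finally have "ennreal (Gamma \<alpha>) * 1 = ennreal (Gamma \<alpha>) * (\<integral>\<^sup>+x. ennreal (gamma_density \<alpha> \<beta> x) \<partial>lborel)"
    by simp
  then show ?thesis using pos by (subst (asm) ennreal_mult_cancel_left) (auto simp: ennreal_eq_0_iff)
qed

lemma has_bochner_integral_gamma_density: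
  assumes "0 < \<alpha>" "0 < \<beta>"
  shows "has_bochner_integral lborel (gamma_density \<alpha> \<beta>) 1"
  using assms by (intro has_bochner_integral_nn_integral)
    (auto simp: nn_integral_gamma_density gamma_density_nonneg)

text \<open>Tied to the density and not to a random variable, because the transform for shape
  \<alpha> + 1 is needed as well.\<close>

definition gamma_fourier :: "real \<Rightarrow> real \<Rightarrow> real \<Rightarrow> complex" where
  "gamma_fourier \<alpha> \<beta> s = (\<integral>x. of_real (gamma_density \<alpha> \<beta> x) * iexp (s * x) \<partial>lborel)"

lemma gamma_fourier_integrable:
  assumes "0 < \<alpha>" "0 < \<beta>"
  shows "integrable lborel (\<lambda>x. of_real (gamma_density \<alpha> \<beta> x) * iexp (s * x))"
proof (rule Bochner_Integration.integrable_bound)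
  show "integrable lborel (gamma_density \<alpha> \<beta>)"
    using has_bochner_integral_gamma_density[OF assms] by (rule integrable.intros)
  show "(\<lambda>x. complex_of_real (gamma_density \<alpha> \<beta> x) * iexp (s * x)) \<in> borel_measurable lborel"
    by measurable
qed (simp add: norm_mult)

lemma gamma_fourier_0:
  assumes "0 < \<alpha>" "0 < \<beta>"
  shows "gamma_fourier \<alpha> \<beta> 0 = 1"
  using has_bochner_integral_gamma_density[OF assms]
  by (simp add: gamma_fourier_def has_bochner_integral_iff)

text \<open>Differentiation under the integral, with an explicit remainder: |exp(ihx) - 1 - ihx| is
  at most (hx)^2 / 2, and the second moment is finite.\<close>

lemma gamma_fourier_has_vector_derivative:
  assumes "0 < \<alpha>" "0 < \<beta>"
  shows "(gamma_fourier \<alpha> \<beta> has_vector_derivative \<i> * of_real (\<alpha> / \<beta>) * gamma_fourier (\<alpha> + 1) \<beta> s) (at s)"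
  unfolding has_vector_derivative_def
proof (rule has_derivativeI_sandwich[where e = 1])
  \<comment> \<open>The second moment of the gamma law, obtained by size biasing twice.\<close>
  define C where "C = \<alpha> / \<beta> * ((\<alpha> + 1) / \<beta>)"
  let ?d = "gamma_density \<alpha> \<beta>"
  have sq: "x^2 * ?d x = C * gamma_density (\<alpha> + 2) \<beta> x" for x
    using gamma_density_mult[of \<alpha> \<beta> x] gamma_density_mult[of "\<alpha> + 1" \<beta> x] assms
    by (simp add: C_def power2_eq_square add_ac mult.assoc) (simp add: mult_ac)
  have int0: "integrable lborel (\<lambda>x. of_real (?d x) * iexp (s * x))" for s
    using assms by (rule gamma_fourier_integrable)
  have int1: "integrable lborel (\<lambda>x. of_real (gamma_density (\<alpha> + 1) \<beta> x) * iexp (s * x))"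
    using assms by (intro gamma_fourier_integrable) auto
  fix y :: real
  define h where "h = y - s"
  have "gamma_fourier \<alpha> \<beta> y - gamma_fourier \<alpha> \<beta> s
      - h *\<^sub>R (\<i> * of_real (\<alpha> / \<beta>) * gamma_fourier (\<alpha> + 1) \<beta> s)
    = (\<integral>x. of_real (?d x) * iexp (y * x) - of_real (?d x) * iexp (s * x)
        - (of_real h * \<i> * of_real (\<alpha> / \<beta>)) * (of_real (gamma_density (\<alpha> + 1) \<beta> x) * iexp (s * x)) \<partial>lborel)"
    unfolding gamma_fourier_def using int0 int1
    by (simp add: scaleR_conv_of_real mult.assoc)
  \<comment> \<open>The sum over \<open>k\<close> up to 1 is the Taylor polynomial 1 + ihx, in the
    form of \<open>iexp_approx1\<close>.\<close>
  also have "\<dots> = (\<integral>x. of_real (?d x) * iexp (s * x) * (iexp (h * x) - (\<Sum>k\<le>1. (\<i> * of_real (h * x)) ^ k / fact k)) \<partial>lborel)"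
  proof (rule Bochner_Integration.integral_cong)
    fix x
    have "iexp (y * x) = iexp (s * x) * iexp (h * x)"
      by (simp add: h_def algebra_simps flip: exp_add)
    moreover have "of_real (\<alpha> / \<beta>) * of_real (gamma_density (\<alpha> + 1) \<beta> x) = complex_of_real x * of_real (?d x)"
      unfolding of_real_mult[symmetric] using gamma_density_mult[OF assms, of x] by simp
    moreover have "(of_real h * \<i> * of_real (\<alpha> / \<beta>)) * (of_real (gamma_density (\<alpha> + 1) \<beta> x) * iexp (s * x))
      = of_real h * \<i> * (of_real (\<alpha> / \<beta>) * of_real (gamma_density (\<alpha> + 1) \<beta> x)) * iexp (s * x)"
      by (simp only: mult_ac)
    ultimately have *: "iexp (y * x) = iexp (s * x) * iexp (h * x)"
      "(of_real h * \<i> * of_real (\<alpha> / \<beta>)) * (of_real (gamma_density (\<alpha> + 1) \<beta> x) * iexp (s * x))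
      = of_real h * \<i> * (complex_of_real x * of_real (?d x)) * iexp (s * x)" by (simp_all only:)
    show "of_real (?d x) * iexp (y * x) - of_real (?d x) * iexp (s * x)
        - (of_real h * \<i> * of_real (\<alpha> / \<beta>)) * (of_real (gamma_density (\<alpha> + 1) \<beta> x) * iexp (s * x))
      = of_real (?d x) * iexp (s * x) * (iexp (h * x) - (\<Sum>k\<le>1. (\<i> * of_real (h * x)) ^ k / fact k))"
      unfolding * by (simp add: algebra_simps)
  qed simp
  also have "norm \<dots> \<le> (\<integral>x. (h^2 * C / 2) * gamma_density (\<alpha> + 2) \<beta> x \<partial>lborel)"
  proof -
    let ?g = "\<lambda>x. of_real (?d x) * iexp (s * x) * (iexp (h * x) - (\<Sum>k\<le>1. (\<i> * of_real (h * x)) ^ k / fact k))"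
    have "has_bochner_integral lborel (gamma_density (\<alpha> + 2) \<beta>) 1"
      using assms by (intro has_bochner_integral_gamma_density) auto
    then have int2: "integrable lborel (\<lambda>x. (h^2 * C / 2) * gamma_density (\<alpha> + 2) \<beta> x)"
      by (auto simp: has_bochner_integral_iff)
    have le: "norm (?g x) \<le> (h^2 * C / 2) * gamma_density (\<alpha> + 2) \<beta> x" for x
    proof -
      have "norm (?g x) = ?d x * norm (iexp (h * x) - (\<Sum>k\<le>1. (\<i> * of_real (h * x)) ^ k / fact k))"
        using assms gamma_density_nonneg by (simp add: norm_mult)
      also have "\<dots> \<le> ?d x * (\<bar>h * x\<bar> ^ Suc 1 / fact (Suc 1))"
        using assms gamma_density_nonneg iexp_approx1[of "h * x" 1] by (intro mult_left_mono) auto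
      also have "\<dots> = h^2 / 2 * (x^2 * ?d x)"
        by (simp add: power2_eq_square flip: abs_mult)
      also have "\<dots> = (h^2 * C / 2) * gamma_density (\<alpha> + 2) \<beta> x" unfolding sq by simp
      finally show ?thesis .
    qed
    have "integrable lborel ?g"
      using le by (intro Bochner_Integration.integrable_bound[OF int2] AE_I2)
        (auto intro: order_trans[OF _ abs_ge_self])
    then have "(\<integral>x. norm (?g x) \<partial>lborel) \<le> (\<integral>x. (h^2 * C / 2) * gamma_density (\<alpha> + 2) \<beta> x \<partial>lborel)"
      using int2 le by (intro integral_mono) auto
    with integral_norm_bound[of lborel ?g] show ?thesis by (rule order_trans)
  qed
  also have "\<dots> = h^2 * C / 2"
    using has_bochner_integral_gamma_density[of "\<alpha> + 2" \<beta>] assms by (simp add: has_bochner_integral_iff)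
  finally have "norm (gamma_fourier \<alpha> \<beta> y - gamma_fourier \<alpha> \<beta> s
      - (y - s) *\<^sub>R (\<i> * of_real (\<alpha> / \<beta>) * gamma_fourier (\<alpha> + 1) \<beta> s)) \<le> (y - s)^2 * C / 2"
    unfolding h_def .
  then show "y \<noteq> s \<Longrightarrow> norm (gamma_fourier \<alpha> \<beta> y - gamma_fourier \<alpha> \<beta> s
      - (y - s) *\<^sub>R (\<i> * of_real (\<alpha> / \<beta>) * gamma_fourier (\<alpha> + 1) \<beta> s)) / norm (y - s) \<le> \<bar>y - s\<bar> * (C / 2)"
    by (simp add: divide_le_eq power2_eq_square mult_ac flip: abs_mult)
next
  show "((\<lambda>y. \<bar>y - s\<bar> * (\<alpha> / \<beta> * ((\<alpha> + 1) / \<beta>) / 2)) \<longlongrightarrow> 0) (at s)"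
    using assms by (auto intro!: tendsto_eq_intros)
qed (auto intro: bounded_linear_scaleR_left)

text \<open>Integration by parts: the density of shape \<alpha> + 1 times exp(isx) has derivative
  \<open>f\<close> on the positive axis and vanishes at both ends, so \<open>f\<close> integrates to
  0, which is the claimed recursion.\<close>

lemma gamma_fourier_Suc:
  assumes "0 < \<alpha>" "0 < \<beta>"
  shows "(1 - \<i> * of_real (s / \<beta>)) * gamma_fourier (\<alpha> + 1) \<beta> s = gamma_fourier \<alpha> \<beta> s"
proof -
  define f where "f x = of_real \<beta> * (of_real (gamma_density \<alpha> \<beta> x) * iexp (s * x))
      + (\<i> * of_real s - of_real \<beta>) * (of_real (gamma_density (\<alpha> + 1) \<beta> x) * iexp (s * x))" for x
  define F where "F x = of_real (gamma_density (\<alpha> + 1) \<beta> x) * iexp (s * x)" for x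
  have int: "integrable lborel (\<lambda>x. of_real (gamma_density \<alpha> \<beta> x) * iexp (s * x))"
      "integrable lborel (\<lambda>x. of_real (gamma_density (\<alpha> + 1) \<beta> x) * iexp (s * x))"
    using gamma_fourier_integrable[of \<alpha> \<beta> s] gamma_fourier_integrable[of "\<alpha> + 1" \<beta> s] assms by auto
  have f_int: "integrable lborel f" unfolding f_def using int by auto
  \<comment> \<open>Since the densities vanish at and below 0, the integral over the half-line is
    the one over the whole line.\<close>
  have f_ind: "indicator (einterval 0 \<infinity>) x *\<^sub>R f x = f x" for x
    by (cases "x \<le> 0") (auto simp: f_def gamma_density_nonpos einterval_def zero_ereal_def)
  define K where "K = \<beta> powr (\<alpha> + 1) / Gamma (\<alpha> + 1)"
  have K: "gamma_density (\<alpha> + 1) \<beta> x = K * (x powr \<alpha> * exp (- \<beta> * x))" if "0 < x" for x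
    using that by (simp add: gamma_density_def K_def)
  have K': "\<beta> * gamma_density \<alpha> \<beta> x = K * (\<alpha> * x powr (\<alpha> - 1) * exp (- \<beta> * x))" if "0 < x" for x
    using that assms powr_mult_base[of \<beta> \<alpha>] Gamma_real_pos[of \<alpha>] Gamma_real_plus1[of \<alpha>]
    by (simp add: gamma_density_def K_def field_simps)
  have deriv: "(gamma_density (\<alpha> + 1) \<beta> has_real_derivative
      \<beta> * gamma_density \<alpha> \<beta> x - \<beta> * gamma_density (\<alpha> + 1) \<beta> x) (at x)" if "0 < x" for x
  proof -
    have "((\<lambda>x. K * (x powr \<alpha> * exp (- \<beta> * x))) has_real_derivative
      \<beta> * gamma_density \<alpha> \<beta> x - \<beta> * gamma_density (\<alpha> + 1) \<beta> x) (at x)"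
      unfolding K'[OF that] K[OF that] using that
      by (auto intro!: derivative_eq_intros simp: algebra_simps)
    then show ?thesis
      by (rule has_field_derivative_transform_within_open[of _ _ _ "{0<..}"]) (use that K in auto)
  qed
  have "(LBINT x=0..\<infinity>. f x) = 0 - 0"
  proof (rule interval_integral_FTC_integrable[where F = F])
    fix x :: real assume "0 < ereal x"
    then have x: "0 < x" by simp
    have iexp_deriv: "((\<lambda>x. iexp (s * x)) has_vector_derivative \<i> * of_real s * iexp (s * x)) (at x)"
    proof -
      have "((\<lambda>x. s * x) has_vector_derivative s) (at x)"
        by (auto intro!: derivative_eq_intros)
      from vector_diff_chain_at[OF this has_vector_derivative_iexp] show ?thesis
        by (simp add: o_def scaleR_conv_of_real mult_ac)
    qed
    show "(F has_vector_derivative f x) (at x)"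
      unfolding F_def[abs_def] f_def
      using has_vector_derivative_mult[OF has_vector_derivative_of_real[OF deriv[OF x]] iexp_deriv]
      by (simp add: algebra_simps)
    have "isCont (gamma_density a \<beta>) x" for a
    proof -
      have "isCont (\<lambda>x. \<beta> powr a * x powr (a - 1) / Gamma a * exp (- \<beta> * x)) x"
        using x unfolding divide_inverse by (intro continuous_intros) auto
      moreover have "\<forall>\<^sub>F y in nhds x. gamma_density a \<beta> y = \<beta> powr a * y powr (a - 1) / Gamma a * exp (- \<beta> * y)"
        by (rule eventually_mono[OF eventually_nhds_in_open[of "{0<..}" x]]) (use x in \<open>auto simp: gamma_density_def\<close>)
      ultimately show ?thesis by (simp add: isCont_cong)
    qed
    then show "isCont f x" unfolding f_def[abs_def] by (intro continuous_intros) auto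
  next
    show "set_integrable lborel (einterval 0 \<infinity>) f"
      using f_int unfolding set_integrable_def f_ind .
  next
    \<comment> \<open>The raised shape matters here: x^\<alpha> tends to 0 for every positive
      \<alpha>, while the density of shape \<alpha> may blow up.\<close>
    have "((\<lambda>x. K * (x powr \<alpha> * exp (- \<beta> * x))) \<longlongrightarrow> 0) (at_right 0)"
      using assms by real_asymp
    then have "(gamma_density (\<alpha> + 1) \<beta> \<longlongrightarrow> 0) (at_right 0)"
      by (rule Lim_transform_eventually) (auto simp: eventually_at_filter K)
    then have "(F \<longlongrightarrow> 0) (at_right 0)"
      unfolding F_def[abs_def] by (intro tendsto_norm_zero_cancel[of "\<lambda>x. _ x * _ x"])
        (auto simp: norm_mult intro: tendsto_rabs_zero)
    then show "((F \<circ> real_of_ereal) \<longlongrightarrow> 0) (at_right 0)"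
      by (simp add: zero_ereal_def ereal_tendsto_simps)
  next
    have "((\<lambda>x. K * (x powr \<alpha> * exp (- \<beta> * x))) \<longlongrightarrow> 0) at_top"
      using assms by real_asymp
    then have "(gamma_density (\<alpha> + 1) \<beta> \<longlongrightarrow> 0) at_top"
      by (rule Lim_transform_eventually) (auto intro: eventually_mono[OF eventually_gt_at_top[of 0]] simp: K)
    then have "(F \<longlongrightarrow> 0) at_top"
      unfolding F_def[abs_def] by (intro tendsto_norm_zero_cancel[of "\<lambda>x. _ x * _ x"])
        (auto simp: norm_mult intro: tendsto_rabs_zero)
    then show "((F \<circ> real_of_ereal) \<longlongrightarrow> 0) (at_left \<infinity>)"
      by (simp add: ereal_tendsto_simps)
  qed simp
  then have "(\<integral>x. f x \<partial>lborel) = 0"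
    by (simp add: interval_lebesgue_integral_def set_lebesgue_integral_def f_ind)
  then have "of_real \<beta> * gamma_fourier \<alpha> \<beta> s + (\<i> * of_real s - of_real \<beta>) * gamma_fourier (\<alpha> + 1) \<beta> s = 0"
    unfolding f_def gamma_fourier_def using int by simp
  then show ?thesis using assms by (simp add: field_simps)
qed

definition gamma_char :: "real \<Rightarrow> real \<Rightarrow> real \<Rightarrow> complex" where
  "gamma_char \<alpha> \<beta> t = (1 - \<i> * of_real (t / \<beta>)) powr (- of_real \<alpha>)"

lemma one_minus_imag_notin_nonpos: "1 - \<i> * complex_of_real t \<notin> \<real>\<^sub>\<le>\<^sub>0"
  by (auto simp: complex_nonpos_Reals_iff)

text \<open>Both sides solve the differential equation \<open>(\<beta> - \<i> s) y' = \<i> \<alpha> y\<close> with \<open>y 0 = 1\<close>.\<close>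

lemma gamma_fourier_eq_gamma_char:
  assumes "0 < \<alpha>" "0 < \<beta>"
  shows "gamma_fourier \<alpha> \<beta> t = gamma_char \<alpha> \<beta> t"
proof -
  define u where "u s = 1 - \<i> * complex_of_real (s / \<beta>)" for s
  have u: "u s \<notin> \<real>\<^sub>\<le>\<^sub>0" "u s \<noteq> 0" for s
    using one_minus_imag_notin_nonpos[of "s / \<beta>"] by (auto simp: u_def)
  \<comment> \<open>\<open>H\<close> is the transform divided by the expected solution. In its
    derivative the recursion \<open>gamma_fourier_Suc\<close> makes the two terms cancel, so
    \<open>H\<close> keeps its value 1 at 0.\<close>
  define H where "H s = gamma_fourier \<alpha> \<beta> s * u s powr of_real \<alpha>" for s
  have "(H has_vector_derivative 0) (at s)" for s
  proof -
    have "(u has_vector_derivative - (\<i> / of_real \<beta>)) (at s)"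
      unfolding u_def[abs_def] by (auto intro!: derivative_eq_intros simp: divide_inverse)
    from field_vector_diff_chain_at[OF this has_field_derivative_powr[OF u(1)]]
    have "((\<lambda>s. u s powr of_real \<alpha>) has_vector_derivative
        - (\<i> / of_real \<beta>) * (of_real \<alpha> * u s powr (of_real \<alpha> - 1))) (at s)"
      by (simp add: o_def)
    from has_vector_derivative_mult[OF gamma_fourier_has_vector_derivative[OF assms] this]
    have "(H has_vector_derivative gamma_fourier \<alpha> \<beta> s * (- (\<i> / of_real \<beta>) * (of_real \<alpha> * u s powr (of_real \<alpha> - 1)))
        + \<i> * of_real (\<alpha> / \<beta>) * gamma_fourier (\<alpha> + 1) \<beta> s * u s powr of_real \<alpha>) (at s)"
      unfolding H_def[abs_def] .
    moreover have "gamma_fourier \<alpha> \<beta> s * (- (\<i> / of_real \<beta>) * (of_real \<alpha> * u s powr (of_real \<alpha> - 1)))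
        + \<i> * of_real (\<alpha> / \<beta>) * gamma_fourier (\<alpha> + 1) \<beta> s * u s powr of_real \<alpha> = 0"
    proof -
      have 1: "u s powr of_real \<alpha> = u s * u s powr (of_real \<alpha> - 1)"
        using u(2)[of s] by (simp add: powr_diff)
      have 2: "gamma_fourier \<alpha> \<beta> s = u s * gamma_fourier (\<alpha> + 1) \<beta> s"
        using gamma_fourier_Suc[OF assms, of s] by (simp add: u_def)
      show ?thesis unfolding 1 2 by (simp add: mult_ac)
    qed
    ultimately show ?thesis by (simp only:)
  qed
  then obtain c where c: "\<And>s. s \<in> UNIV \<Longrightarrow> H s = c"
    using has_vector_derivative_zero_constant[OF convex_UNIV, of H] by blast
  have "H t = H 0" using c[of t] c[of 0] by simp
  also have "\<dots> = 1" using gamma_fourier_0[OF assms] by (simp add: H_def u_def)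
  finally show ?thesis
    using u(2)[of t] unfolding H_def gamma_char_def u_def[symmetric]
    by (simp add: powr_minus field_simps)
qed

lemma char_gamma_distributed:
  assumes "gamma_distributed M X \<alpha> \<beta>" "0 < \<alpha>" "0 < \<beta>"
  shows "char (distr M borel X) t = gamma_char \<alpha> \<beta> t"
proof -
  have "distr M borel X = distr M lborel X" by (rule distr_cong) auto
  also have "\<dots> = density lborel (\<lambda>t. ennreal (gamma_density \<alpha> \<beta> t))"
    using assms by (simp add: gamma_distributed_def distributed_distr_eq_density)
  finally have distr_eq: "distr M borel X = density lborel (\<lambda>t. ennreal (gamma_density \<alpha> \<beta> t))" .
  have "char (distr M borel X) t
      = (\<integral>x. iexp (t * x) \<partial>density lborel (\<lambda>t. ennreal (gamma_density \<alpha> \<beta> t)))"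
    unfolding char_def distr_eq ..
  also have "\<dots> = gamma_fourier \<alpha> \<beta> t"
    unfolding gamma_fourier_def using assms
    by (subst integral_density) (auto simp: gamma_density_nonneg scaleR_conv_of_real)
  finally show ?thesis using gamma_fourier_eq_gamma_char assms by simp
qed

section \<open>From negative binomial to gamma\<close>

text \<open>With h = it/N the base equals exp(h) - N (exp(h) - 1) / \<beta>, which tends to 1 -
  it/\<beta>. The limit has real part 1, so the principal power is continuous there.\<close>

lemma negbin_char_tendsto_gamma_char:
  fixes N :: "nat \<Rightarrow> real"
  assumes "0 < \<beta>" and N: "filterlim N at_top sequentially" "\<And>m. 0 < N m"
  shows "(\<lambda>m. negbin_char \<alpha> (\<beta> / N m) (t / N m)) \<longlonglongrightarrow> gamma_char \<alpha> \<beta> t"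
proof -
  define h where "h m = \<i> * of_real (t / N m)" for m
  have inv: "(\<lambda>m. inverse (N m)) \<longlonglongrightarrow> 0"
    using N(1) by (rule tendsto_inverse_0_at_top)
  have "h \<longlonglongrightarrow> \<i> * of_real (t * 0)"
    unfolding h_def divide_inverse by (intro tendsto_mult tendsto_of_real tendsto_const inv)
  then have h: "h \<longlonglongrightarrow> 0" by simp
  have "(\<lambda>m. of_real (N m) * (exp (h m) - 1)) \<longlonglongrightarrow> \<i> * of_real t"
  \<comment> \<open>The limit of (exp(h) - 1) / h requires h to be nonzero.\<close>
  proof (cases "t = 0")
    case False
    then have "h m \<noteq> 0" for m using N(2)[of m] by (auto simp: h_def)
    then have "filterlim h (at 0) sequentially" using h by (auto simp: filterlim_at)
    from filterlim_compose[OF lim_exp_minus_1 this]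
    have "(\<lambda>m. \<i> * of_real t * ((exp (h m) - 1) / h m)) \<longlonglongrightarrow> \<i> * of_real t * 1"
      by (intro tendsto_mult tendsto_const)
    moreover have "\<i> * of_real t * ((exp (h m) - 1) / h m) = of_real (N m) * (exp (h m) - 1)" for m
      using False N(2)[of m] by (simp add: h_def)
    ultimately show ?thesis by simp
  qed (simp add: h_def)
  then have "(\<lambda>m. exp (h m) - of_real (N m) * (exp (h m) - 1) / of_real \<beta>) \<longlonglongrightarrow> exp 0 - \<i> * of_real t / of_real \<beta>"
    using assms(1) by (intro tendsto_diff tendsto_exp tendsto_divide tendsto_const h) auto
  moreover have "exp (h m) - of_real (N m) * (exp (h m) - 1) / of_real \<beta>
      = (1 - of_real (1 - \<beta> / N m) * iexp (t / N m)) / of_real (\<beta> / N m)" for m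
    using assms(1) N(2)[of m] by (simp add: h_def field_simps)
  ultimately have "(\<lambda>m. (1 - of_real (1 - \<beta> / N m) * iexp (t / N m)) / of_real (\<beta> / N m)) \<longlonglongrightarrow> 1 - \<i> * of_real (t / \<beta>)"
    by simp
  then show ?thesis
    unfolding negbin_char_def gamma_char_def
    by (intro tendsto_powr_complex one_minus_imag_notin_nonpos tendsto_const)
qed

text \<open>Markov's inequality. The left end -1 keeps the atom at 0 inside the half-open interval
  that \<open>tight\<close> uses.\<close>

lemma measure_scaled_pmf_tail:
  fixes Z :: "nat pmf"
  assumes "0 < N" "0 < b" "0 \<le> C" "(\<integral>\<^sup>+k. real k \<partial>measure_pmf Z) \<le> ennreal (C * N)"
  shows "1 - C / b \<le> measure (distr (measure_pmf Z) borel (\<lambda>k. real k / N)) {-1<..b}"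
proof -
  \<comment> \<open>The event that \<open>k\<close> is at least \<open>b * N\<close>, in the
    normalized form of Markov's inequality.\<close>
  let ?B = "{k. 1 \<le> ennreal (1 / (b * N)) * ennreal (real k)}"
  have "emeasure (measure_pmf Z) ?B \<le> ennreal (1 / (b * N)) * (\<integral>\<^sup>+k. real k \<partial>measure_pmf Z)"
    using nn_integral_Markov_inequality[where u = "\<lambda>k. ennreal (real k)" and M = "measure_pmf Z"
        and A = UNIV and c = "ennreal (1 / (b * N))"]
    by simp
  also have "\<dots> \<le> ennreal (1 / (b * N)) * ennreal (C * N)"
    using assms by (intro mult_left_mono) auto
  also have "\<dots> = ennreal (C / b)"
    using assms by (simp flip: ennreal_mult'')
  finally have B: "measure (measure_pmf Z) ?B \<le> C / b"
    using assms by (simp add: measure_pmf.emeasure_eq_measure)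
  have "- ?B \<subseteq> (\<lambda>k. real k / N) -` {-1<..b}"
  proof
    fix k assume "k \<in> - ?B"
    then have "\<not> 1 \<le> real k / (b * N)"
      using assms by (simp flip: ennreal_mult')
    then show "k \<in> (\<lambda>k. real k / N) -` {-1<..b}"
      using assms by (auto simp: field_simps intro: less_le_trans[of _ 0])
  qed
  then have "measure (measure_pmf Z) (- ?B) \<le> measure (measure_pmf Z) ((\<lambda>k. real k / N) -` {-1<..b})"
    by (intro measure_pmf.finite_measure_mono) auto
  also have "\<dots> = measure (distr (measure_pmf Z) borel (\<lambda>k. real k / N)) {-1<..b}"
    by (simp add: measure_distr)
  finally show ?thesis
    using B measure_pmf.prob_compl[of ?B Z] by (simp add: Compl_eq_Diff_UNIV)
qed

text \<open>The bounded continuous test function \<open>f\<close> is nonnegative and vanishes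
  exactly on the nonnegative half-line, so its zero integrals pass to the limit and force the
  claim.\<close>

lemma AE_nonneg_weak_limit:
  assumes "\<And>n. real_distribution (\<mu> n)" "real_distribution \<nu>" "weak_conv_m \<mu> \<nu>"
    and "\<And>n. AE x in \<mu> n. 0 \<le> x"
  shows "AE x in \<nu>. 0 \<le> x"
proof -
  interpret real_distribution \<nu> by fact
  define f :: "real \<Rightarrow> real" where "f x = min 1 (max 0 (- x))" for x
  have "(\<lambda>n. \<integral>x. f x \<partial>\<mu> n) \<longlonglongrightarrow> (\<integral>x. f x \<partial>\<nu>)"
    using assms(1-3)
    by (rule weak_conv_imp_integral_bdd_continuous_conv[where B = 1])
      (auto simp: f_def[abs_def] intro!: continuous_intros)
  moreover have "(\<integral>x. f x \<partial>\<mu> n) = 0" for n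
    using assms(4)[of n] by (intro integral_eq_zero_AE) (auto simp: f_def)
  ultimately have "(\<integral>x. f x \<partial>\<nu>) = 0" by (simp add: LIMSEQ_const_iff)
  moreover have "integrable \<nu> f"
    by (rule integrable_const_bound[where B = 1]) (auto simp: f_def [abs_def])
  ultimately have "AE x in \<nu>. f x = 0"
    by (subst (asm) integral_nonneg_eq_0_iff_AE) (auto simp: f_def)
  then show ?thesis by eventually_elim (auto simp: f_def min_def max_def split: if_splits)
qed

text \<open>The quotient of the products must be shown to be a characteristic function. It arises as
  the limit of the transforms of the rescaled laws \<mu>, along a subsequence supplied by
  tightness.\<close>

lemma gamma_char_quotient:
  fixes \<alpha>1 \<alpha>2 \<beta>1 \<beta>2 :: "nat \<Rightarrow> real"
  assumes pos: "\<And>i. i < n \<Longrightarrow> 0 < \<alpha>1 i" "\<And>i. i < n \<Longrightarrow> 0 < \<alpha>2 i"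
      "\<And>i. i < n \<Longrightarrow> 0 < \<beta>1 i" "\<And>i. i < n \<Longrightarrow> 0 < \<beta>2 i"
    and le: "\<And>m k. 0 < m \<Longrightarrow> (\<And>i. i < n \<Longrightarrow> \<beta>1 i < m \<and> \<beta>2 i < m)
      \<Longrightarrow> (\<Sum>i<n. \<alpha>1 i * (1 - \<beta>1 i / m) ^ k) \<le> (\<Sum>i<n. \<alpha>2 i * (1 - \<beta>2 i / m) ^ k)"
  obtains \<nu> where "real_distribution \<nu>" "AE x in \<nu>. 0 \<le> x"
    "\<And>t. (\<Prod>i<n. gamma_char (\<alpha>2 i) (\<beta>2 i) t) = (\<Prod>i<n. gamma_char (\<alpha>1 i) (\<beta>1 i) t) * char \<nu> t"
proof -
  \<comment> \<open>\<open>m0\<close> exceeds every rate, so the rates divided by \<open>N m\<close>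
    are success probabilities from \<open>m = 0\<close> on.\<close>
  define m0 where "m0 = 1 + (\<Sum>i<n. \<beta>1 i + \<beta>2 i)"
  have sum_nn: "0 \<le> \<beta>1 i + \<beta>2 i" if "i < n" for i using pos(3,4) that by (simp add: add_nonneg_nonneg less_imp_le)
  then have "0 \<le> (\<Sum>i<n. \<beta>1 i + \<beta>2 i)" by (intro sum_nonneg) simp
  then have m0_pos: "0 < m0" unfolding m0_def by linarith
  have m0: "\<beta>1 i < m0 \<and> \<beta>2 i < m0" if "i < n" for i
    using member_le_sum[of i "{..<n}" "\<lambda>i. \<beta>1 i + \<beta>2 i"] sum_nn that pos(3)[OF that] pos(4)[OF that]
    by (auto simp: m0_def)
  define N where "N m = m0 + real m" for m
  have N_pos: "0 < N m" for m using m0_pos by (simp add: N_def)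
  have N_gt: "\<beta>1 i < N m \<and> \<beta>2 i < N m" if "i < n" for i m using m0[OF that] by (simp add: N_def)
  have N_lim: "filterlim N at_top sequentially"
    unfolding N_def[abs_def] by (intro filterlim_tendsto_add_at_top[OF tendsto_const] filterlim_real_sequentially)
  \<comment> \<open>Dividing the rates by \<open>N m\<close> multiplies the mean bound by
    \<open>N m\<close>, so after rescaling all means are at most \<open>C\<close>.\<close>
  define C where "C = (\<Sum>i<n. \<alpha>2 i / \<beta>2 i)"
  have "0 \<le> C" unfolding C_def using pos by (intro sum_nonneg divide_nonneg_pos) (auto simp: less_imp_le)
  define good where "good m Z \<longleftrightarrow> (\<forall>t. (\<Prod>i<n. negbin_char (\<alpha>2 i) (\<beta>2 i / N m) t)
        = (\<Prod>i<n. negbin_char (\<alpha>1 i) (\<beta>1 i / N m) t) * (\<integral>k. iexp (t * real k) \<partial>measure_pmf Z))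
      \<and> (\<integral>\<^sup>+k. real k \<partial>measure_pmf Z) \<le> ennreal (C * N m)" for m Z
  have "\<exists>Z. good m Z" for m
  proof (rule negbin_char_quotient[of n "\<lambda>i. \<beta>1 i / N m" "\<lambda>i. \<beta>2 i / N m" \<alpha>1 \<alpha>2])
    fix Z :: "nat pmf"
    assume "\<And>t. (\<Prod>i<n. negbin_char (\<alpha>2 i) (\<beta>2 i / N m) t)
        = (\<Prod>i<n. negbin_char (\<alpha>1 i) (\<beta>1 i / N m) t) * (\<integral>k. iexp (t * real k) \<partial>measure_pmf Z)"
      and "(\<integral>\<^sup>+k. real k \<partial>measure_pmf Z) \<le> ennreal (\<Sum>i<n. \<alpha>2 i / (\<beta>2 i / N m))"
    then show ?thesis by (intro exI[of _ Z]) (simp add: good_def C_def sum_distrib_right)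
  qed (use pos N_pos N_gt le in auto)
  then obtain Z where "\<And>m. good m (Z m)" by metis
  then have Z: "(\<Prod>i<n. negbin_char (\<alpha>2 i) (\<beta>2 i / N m) t)
        = (\<Prod>i<n. negbin_char (\<alpha>1 i) (\<beta>1 i / N m) t) * (\<integral>k. iexp (t * real k) \<partial>measure_pmf (Z m))"
      and Z_mean: "(\<integral>\<^sup>+k. real k \<partial>measure_pmf (Z m)) \<le> ennreal (C * N m)" for m t
    unfolding good_def by blast+
  define \<mu> where "\<mu> m = distr (measure_pmf (Z m)) borel (\<lambda>k. real k / N m)" for m
  have \<mu>: "real_distribution (\<mu> m)" for m
    unfolding \<mu>_def by (rule prob_space.real_distribution_distr[OF prob_space_measure_pmf]) simp
  have \<mu>_nonneg: "AE x in \<mu> m. 0 \<le> x" for m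
    unfolding \<mu>_def using N_pos[of m] by (subst AE_distr_iff) auto
  have \<mu>_char: "(\<Prod>i<n. negbin_char (\<alpha>2 i) (\<beta>2 i / N m) (t / N m))
      = (\<Prod>i<n. negbin_char (\<alpha>1 i) (\<beta>1 i / N m) (t / N m)) * char (\<mu> m) t" for m t
    unfolding Z \<mu>_def char_def by (subst integral_distr) auto
  have "tight \<mu>"
    unfolding tight_def
  proof (intro conjI allI impI \<mu>)
    fix \<epsilon> :: real assume \<epsilon>: "0 < \<epsilon>"
    \<comment> \<open>Adding 1 keeps \<open>b\<close> positive and \<open>C / b\<close> strictly
      below \<epsilon> even when \<open>C\<close> is 0.\<close>
    define b where "b = (C + 1) / \<epsilon>"
    have b: "0 < b" "C / b < \<epsilon>" using \<epsilon> \<open>0 \<le> C\<close> by (auto simp: b_def field_simps)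
    have "1 - \<epsilon> < measure (\<mu> m) {-1<..b}" for m
      using measure_scaled_pmf_tail[OF N_pos b(1) \<open>0 \<le> C\<close> Z_mean] b(2) unfolding \<mu>_def
      by (meson diff_strict_left_mono less_le_trans)
    moreover have "-1 < b" using b by simp
    ultimately show "\<exists>a b. a < b \<and> (\<forall>m. 1 - \<epsilon> < measure (\<mu> m) {a<..b})" by blast
  qed
  from tight_imp_convergent_subsubsequence[OF this strict_mono_id]
  obtain r \<nu> where r: "strict_mono r" and \<nu>: "real_distribution \<nu>"
    and conv: "weak_conv_m (\<lambda>k. \<mu> (r k)) \<nu>" by (auto simp: o_def)
  have Nr: "filterlim (\<lambda>k. N (r k)) at_top sequentially"
    using filterlim_compose[OF N_lim filterlim_subseq[OF r]] .
  show thesis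
  proof (rule that[OF \<nu> AE_nonneg_weak_limit[OF \<mu> \<nu> conv \<mu>_nonneg]])
    fix t
    have lim: "(\<lambda>k. \<Prod>i<n. negbin_char (\<alpha> i) (\<beta> i / N (r k)) (t / N (r k)))
        \<longlonglongrightarrow> (\<Prod>i<n. gamma_char (\<alpha> i) (\<beta> i) t)" if "\<And>i. i < n \<Longrightarrow> 0 < \<beta> i" for \<alpha> \<beta> :: "nat \<Rightarrow> real"
      using that N_pos Nr by (intro tendsto_prod negbin_char_tendsto_gamma_char) auto
    \<comment> \<open>The same sequence of products converges to both sides of the claim; the factor
      \<open>char (\<mu> (r k)) t\<close> converges by weak convergence.\<close>
    have "(\<lambda>k. (\<Prod>i<n. negbin_char (\<alpha>1 i) (\<beta>1 i / N (r k)) (t / N (r k))) * char (\<mu> (r k)) t)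
        \<longlonglongrightarrow> (\<Prod>i<n. gamma_char (\<alpha>1 i) (\<beta>1 i) t) * char \<nu> t"
      by (intro tendsto_mult lim pos levy_continuity1[OF \<mu> \<nu> conv])
    then have "(\<lambda>k. \<Prod>i<n. negbin_char (\<alpha>2 i) (\<beta>2 i / N (r k)) (t / N (r k)))
        \<longlonglongrightarrow> (\<Prod>i<n. gamma_char (\<alpha>1 i) (\<beta>1 i) t) * char \<nu> t"
      unfolding \<mu>_char .
    with lim[where \<alpha> = \<alpha>2 and \<beta> = \<beta>2, OF pos(4)]
    show "(\<Prod>i<n. gamma_char (\<alpha>2 i) (\<beta>2 i) t) = (\<Prod>i<n. gamma_char (\<alpha>1 i) (\<beta>1 i) t) * char \<nu> t"
      by (rule LIMSEQ_unique)
  qed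
qed

section \<open>Sums of independent variables and the two parts of the theorem\<close>

lemma conv_le_sum_of_char:
  fixes X1 :: "nat \<Rightarrow> 'a \<Rightarrow> real" and X2 :: "nat \<Rightarrow> 'b \<Rightarrow> real"
  assumes "prob_space M1" "prob_space M2"
    and indep: "prob_space.indep_vars M1 (\<lambda>_. borel) X1 {..<n}" "prob_space.indep_vars M2 (\<lambda>_. borel) X2 {..<n}"
    and char: "\<And>i t. i < n \<Longrightarrow> char (distr M1 borel (X1 i)) t = \<phi>1 i t"
      "\<And>i t. i < n \<Longrightarrow> char (distr M2 borel (X2 i)) t = \<phi>2 i t"
    and \<nu>: "real_distribution \<nu>" "AE x in \<nu>. 0 \<le> x"
      "\<And>t. (\<Prod>i<n. \<phi>2 i t) = (\<Prod>i<n. \<phi>1 i t) * char \<nu> t"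
  shows "conv_le M1 (\<lambda>\<omega>. \<Sum>i<n. X1 i \<omega>) M2 (\<lambda>\<omega>. \<Sum>i<n. X2 i \<omega>)"
proof (rule conv_leI_char[OF assms(1,2) _ _ \<nu>(1,2)])
  interpret M1: prob_space M1 by fact
  interpret M2: prob_space M2 by fact
  show "(\<lambda>\<omega>. \<Sum>i<n. X1 i \<omega>) \<in> borel_measurable M1"
    using indep(1) by (intro borel_measurable_sum) (auto simp: M1.indep_vars_def)
  show "(\<lambda>\<omega>. \<Sum>i<n. X2 i \<omega>) \<in> borel_measurable M2"
    using indep(2) by (intro borel_measurable_sum) (auto simp: M2.indep_vars_def)
  show "char (distr M2 borel (\<lambda>\<omega>. \<Sum>i<n. X2 i \<omega>)) t
      = char (distr M1 borel (\<lambda>\<omega>. \<Sum>i<n. X1 i \<omega>)) t * char \<nu> t" for t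
    unfolding M1.char_distr_sum[OF indep(1)] M2.char_distr_sum[OF indep(2)]
    using char \<nu>(3)[of t] by simp
qed

theorem corollary4p32:
  fixes n :: nat
    and \<alpha>1 \<alpha>2 p1 p2 \<beta>1 \<beta>2 :: "real list"
    and M1 :: "'a measure" and M2 :: "'b measure"
    and N1 G1 :: "nat \<Rightarrow> 'a \<Rightarrow> real" and N2 G2 :: "nat \<Rightarrow> 'b \<Rightarrow> real"
  assumes "n \<ge> 1"
    and "length \<alpha>1 = n" "length \<alpha>2 = n"
    and "length p1 = n" "length p2 = n"
    and "length \<beta>1 = n" "length \<beta>2 = n"
    and "\<forall>i<n. \<alpha>1 ! i > 0" "\<forall>i<n. \<alpha>2 ! i > 0"
    and "\<forall>i<n. 0 < p1 ! i \<and> p1 ! i < 1" "\<forall>i<n. 0 < p2 ! i \<and> p2 ! i < 1"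
    and "\<forall>i<n. \<beta>1 ! i > 0" "\<forall>i<n. \<beta>2 ! i > 0"
    and "prob_space M1" "prob_space M2"
  shows
    "(prob_space.indep_vars M1 (\<lambda>_. borel) N1 {..<n} \<longrightarrow>
      (\<forall>i<n. negbin_distributed M1 (N1 i) (\<alpha>1 ! i) (p1 ! i)) \<longrightarrow>
      prob_space.indep_vars M2 (\<lambda>_. borel) N2 {..<n} \<longrightarrow>
      (\<forall>i<n. negbin_distributed M2 (N2 i) (\<alpha>2 ! i) (p2 ! i)) \<longrightarrow>
      (\<alpha>2, p2) =\<^sup>a (increasing_arr \<alpha>2, decreasing_arr p2) \<longrightarrow>
      \<alpha>1 \<prec>\<^sub>w \<alpha>2 \<longrightarrow>
      p1 \<prec>\<^sup>w p2 \<longrightarrow>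
      conv_le M1 (\<lambda>\<omega>. \<Sum>i<n. N1 i \<omega>) M2 (\<lambda>\<omega>. \<Sum>i<n. N2 i \<omega>))
     \<and>
     (prob_space.indep_vars M1 (\<lambda>_. borel) G1 {..<n} \<longrightarrow>
      (\<forall>i<n. gamma_distributed M1 (G1 i) (\<alpha>1 ! i) (\<beta>1 ! i)) \<longrightarrow>
      prob_space.indep_vars M2 (\<lambda>_. borel) G2 {..<n} \<longrightarrow>
      (\<forall>i<n. gamma_distributed M2 (G2 i) (\<alpha>2 ! i) (\<beta>2 ! i)) \<longrightarrow>
      (\<alpha>2, \<beta>2) =\<^sup>a (increasing_arr \<alpha>2, decreasing_arr \<beta>2) \<longrightarrow>
      \<alpha>1 \<prec>\<^sub>w \<alpha>2 \<longrightarrow>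
      \<beta>1 \<prec>\<^sup>w \<beta>2 \<longrightarrow>
      conv_le M1 (\<lambda>\<omega>. \<Sum>i<n. G1 i \<omega>) M2 (\<lambda>\<omega>. \<Sum>i<n. G2 i \<omega>))"
proof (intro conjI impI)
  assume indep: "prob_space.indep_vars M1 (\<lambda>_. borel) N1 {..<n}" "prob_space.indep_vars M2 (\<lambda>_. borel) N2 {..<n}"
    and dist: "\<forall>i<n. negbin_distributed M1 (N1 i) (\<alpha>1 ! i) (p1 ! i)"
      "\<forall>i<n. negbin_distributed M2 (N2 i) (\<alpha>2 ! i) (p2 ! i)"
    and maj: "(\<alpha>2, p2) =\<^sup>a (increasing_arr \<alpha>2, decreasing_arr p2)" "\<alpha>1 \<prec>\<^sub>w \<alpha>2" "p1 \<prec>\<^sup>w p2"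
  obtain Z :: "nat pmf" where Z: "\<And>t. (\<Prod>i<n. negbin_char (\<alpha>2 ! i) (p2 ! i) t)
      = (\<Prod>i<n. negbin_char (\<alpha>1 ! i) (p1 ! i) t) * (\<integral>k. iexp (t * real k) \<partial>measure_pmf Z)"
  proof (rule negbin_char_quotient[of n "(!) p1" "(!) p2" "(!) \<alpha>1" "(!) \<alpha>2"])
    show "(\<Sum>i<n. \<alpha>1 ! i * (1 - p1 ! i) ^ k) \<le> (\<Sum>i<n. \<alpha>2 ! i * (1 - p2 ! i) ^ k)" for k
      using weak_majorization_power_sum[of \<alpha>1 n \<alpha>2 p1 p2 1 k] assms maj by simp
  qed (use assms in auto)
  show "conv_le M1 (\<lambda>\<omega>. \<Sum>i<n. N1 i \<omega>) M2 (\<lambda>\<omega>. \<Sum>i<n. N2 i \<omega>)"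
  proof (rule conv_le_sum_of_char[OF assms(14,15) indep])
    show "real_distribution (distr (measure_pmf Z) borel real)"
      by (rule prob_space.real_distribution_distr[OF prob_space_measure_pmf]) simp
    show "AE x in distr (measure_pmf Z) borel real. 0 \<le> x"
      by (subst AE_distr_iff) auto
    show "(\<Prod>i<n. negbin_char (\<alpha>2 ! i) (p2 ! i) t)
        = (\<Prod>i<n. negbin_char (\<alpha>1 ! i) (p1 ! i) t) * char (distr (measure_pmf Z) borel real) t" for t
      unfolding Z char_def by (subst integral_distr) auto
  qed (use assms dist in \<open>auto intro: char_negbin_distributed\<close>)
next
  assume indep: "prob_space.indep_vars M1 (\<lambda>_. borel) G1 {..<n}" "prob_space.indep_vars M2 (\<lambda>_. borel) G2 {..<n}"
    and dist: "\<forall>i<n. gamma_distributed M1 (G1 i) (\<alpha>1 ! i) (\<beta>1 ! i)"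
      "\<forall>i<n. gamma_distributed M2 (G2 i) (\<alpha>2 ! i) (\<beta>2 ! i)"
    and maj: "(\<alpha>2, \<beta>2) =\<^sup>a (increasing_arr \<alpha>2, decreasing_arr \<beta>2)" "\<alpha>1 \<prec>\<^sub>w \<alpha>2" "\<beta>1 \<prec>\<^sup>w \<beta>2"
  obtain \<nu> where \<nu>: "real_distribution \<nu>" "AE x in \<nu>. 0 \<le> x"
    "\<And>t. (\<Prod>i<n. gamma_char (\<alpha>2 ! i) (\<beta>2 ! i) t) = (\<Prod>i<n. gamma_char (\<alpha>1 ! i) (\<beta>1 ! i) t) * char \<nu> t"
  proof (rule gamma_char_quotient[of n "(!) \<alpha>1" "(!) \<alpha>2" "(!) \<beta>1" "(!) \<beta>2"])
    \<comment> \<open>The majorization is applied to the rates themselves; the scale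
      \<open>m\<close> enters only through the convex function.\<close>
    fix m :: real and k assume "0 < m" "\<And>i. i < n \<Longrightarrow> \<beta>1 ! i < m \<and> \<beta>2 ! i < m"
    then show "(\<Sum>i<n. \<alpha>1 ! i * (1 - \<beta>1 ! i / m) ^ k) \<le> (\<Sum>i<n. \<alpha>2 ! i * (1 - \<beta>2 ! i / m) ^ k)"
      using assms maj by (intro weak_majorization_power_sum) auto
  qed (use assms in auto)
  show "conv_le M1 (\<lambda>\<omega>. \<Sum>i<n. G1 i \<omega>) M2 (\<lambda>\<omega>. \<Sum>i<n. G2 i \<omega>)"
    by (rule conv_le_sum_of_char[OF assms(14,15) indep _ _ \<nu>])
      (use assms dist in \<open>auto intro: char_gamma_distributed\<close>)
qed

end
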